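(* Let $n\ge 4$ and let $T$ be a triangulation of a regular $n$-gon whose edges are labeled $1,\dots,n$ in cyclic order. Then the cross-ratio degree $d_T$ equals $2^{I(T)}$, where $I(T)$ is the number of triangles of $T$ none of whose three sides is an edge of the $n$-gon.
   Context: For a finite set $A$ with $|A|\ge 3$, $M_{0,A}$ denotes the moduli space of configurations of $|A|$ distinct points on $\mathbb{P}^1_{\mathbb{C}}$ labeled by $A$, modulo Möbius transformations; it is a smooth affine variety of dimension $|A|-3$, and for $S\subseteq A$ with $|S|\ge 3$ there is a forgetful map $M_{0,A}\to M_{0,S}$ remembering only the points labeled by $S$. For $|S|=4$, $M_{0,S}\cong\mathbb{P}^1\setminus\{0,1,\infty\}$ via the cross-ratio. For a collection $\mathcal{V}=(S_1,\dots,S_k)$ of 4-element subsets of $A$, the cross-ratio degree $d_{A,\mathcal{V}}$ is defined as follows: if $k=|A|-3$, it is the degree of the product of forgetful maps $\pi_{\mathcal{V}}:M_{0,A}\to\prod_{j=1}^k M_{0,S_j}$ (the cardinality of a general fiber, taken to be $0$ if the map is not dominant; when $|A|=3$ and $\mathcal{V}$ is empty this is $1$); if $k\neq |A|-3$, set $d_{A,\mathcal{V}}=0$. Triangulations: label the edges of a regular $n$-gon by $[n]=\{1,\dots,n\}$ in cyclic order. A diagonal $D$ touches exactly four edges (the two edges at each endpoint of $D$); let $S_D\subseteq[n]$ be this 4-element set. A triangulation $T$ is a choice of $n-3$ pairwise non-crossing diagonals; let $\mathcal{U}_T=\{S_D: D\in T\}$, and $d_T:=d_{[n],\mathcal{U}_T}$,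 i.e. the degree of $\pi_T:M_{0,[n]}\to\prod_{D\in T}M_{0,S_D}$. *)

theory Defs
  imports Complex_Main "HOL-Library.Product_Lexorder"
begin

text \<open>Configurations of distinct points labelled by A. Every PGL2-orbit of
configurations in P^1 contains configurations avoiding infinity, and two such
configurations lie in the same orbit iff they are related by a Moebius map with
no pole at the points. Functions are normalised to 0 outside A.\<close>

definition config :: "nat set \<Rightarrow> (nat \<Rightarrow> complex) set" where
  "config A = {x. inj_on x A \<and> (\<forall>i. i \<notin> A \<longrightarrow> x i = 0)}"

definition mobius_rel :: "nat set \<Rightarrow> ((nat \<Rightarrow> complex) \<times> (nat \<Rightarrow> complex)) set" where
  "mobius_rel A = {(x, y). x \<in> config A \<and> y \<in> config A \<and>
     (\<exists>a b c d. a * d - b * c \<noteq> 0 \<and>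
        (\<forall>i\<in>A. c * x i + d \<noteq> 0 \<and> y i = (a * x i + b) / (c * x i + d)))}"

definition M0 :: "nat set \<Rightarrow> (nat \<Rightarrow> complex) set set" where
  "M0 A = config A // mobius_rel A"

text \<open>Cross-ratio coordinate on M_{0,S} for a 4-set S = {a<b<c<d}; it identifies
M_{0,S} with P^1 minus {0,1,infinity}.\<close>

definition cross_ratio :: "nat set \<Rightarrow> (nat \<Rightarrow> complex) \<Rightarrow> complex" where
  "cross_ratio S x = (let l = sorted_list_of_set S in
     ((x (l!0) - x (l!2)) * (x (l!1) - x (l!3))) / ((x (l!0) - x (l!3)) * (x (l!1) - x (l!2))))"

definition cr_fiber :: "nat set \<Rightarrow> nat set list \<Rightarrow> (nat \<Rightarrow> complex) \<Rightarrow> (nat \<Rightarrow> complex) set set" where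
  "cr_fiber A V y = {X \<in> M0 A. \<exists>x\<in>X. \<forall>j<length V. cross_ratio (V!j) x = y j}"

inductive poly_fun :: "nat \<Rightarrow> ((nat \<Rightarrow> complex) \<Rightarrow> complex) \<Rightarrow> bool" for k where
  pf_const: "poly_fun k (\<lambda>y. c)"
| pf_var: "i < k \<Longrightarrow> poly_fun k (\<lambda>y. y i)"
| pf_add: "poly_fun k p \<Longrightarrow> poly_fun k q \<Longrightarrow> poly_fun k (\<lambda>y. p y + q y)"
| pf_mult: "poly_fun k p \<Longrightarrow> poly_fun k q \<Longrightarrow> poly_fun k (\<lambda>y. p y * q y)"

definition cr_target :: "nat \<Rightarrow> (nat \<Rightarrow> complex) set" where
  "cr_target k = {y. \<forall>j<k. y j \<noteq> 0 \<and> y j \<noteq> 1}"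

text \<open>Cross-ratio degree: cardinality of the fibre over a general point, i.e. over
every point of the product outside the zero set of some nonzero polynomial.\<close>

definition cr_degree :: "nat set \<Rightarrow> nat set list \<Rightarrow> nat" where
  "cr_degree A V = (if length V + 3 = card A then
     (THE d. \<exists>p. poly_fun (length V) p \<and> (\<exists>y. p y \<noteq> 0) \<and>
        (\<forall>y\<in>cr_target (length V). p y \<noteq> 0 \<longrightarrow> card (cr_fiber A V y) = d))
   else 0)"

text \<open>Vertices 1..n; vertex v is the common endpoint of edges v and nxt n v.\<close>

definition nxt :: "nat \<Rightarrow> nat \<Rightarrow> nat" where
  "nxt n v = (if v = n then 1 else v + 1)"

definition is_side :: "nat \<Rightarrow> nat \<Rightarrow> nat \<Rightarrow> bool" where
  "is_side n u v = (v = nxt n u \<or> u = nxt n v)"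

definition is_diag :: "nat \<Rightarrow> nat \<times> nat \<Rightarrow> bool" where
  "is_diag n D = (case D of (u, v) \<Rightarrow> 1 \<le> u \<and> u < v \<and> v \<le> n \<and> \<not> is_side n u v)"

definition crosses :: "nat \<times> nat \<Rightarrow> nat \<times> nat \<Rightarrow> bool" where
  "crosses D E = (case D of (u, v) \<Rightarrow> case E of (u', v') \<Rightarrow>
      (u < u' \<and> u' < v \<and> v < v') \<or> (u' < u \<and> u < v' \<and> v' < v))"

definition triangulation :: "nat \<Rightarrow> (nat \<times> nat) set \<Rightarrow> bool" where
  "triangulation n T = (finite T \<and> (\<forall>D\<in>T. is_diag n D) \<and> card T = n - 3 \<and>
     (\<forall>D\<in>T. \<forall>E\<in>T. \<not> crosses D E))"

text \<open>The four edges touched by a diagonal.\<close>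

definition S_diag :: "nat \<Rightarrow> nat \<times> nat \<Rightarrow> nat set" where
  "S_diag n D = (case D of (u, v) \<Rightarrow> {u, nxt n u, v, nxt n v})"

definition d_T :: "nat \<Rightarrow> (nat \<times> nat) set \<Rightarrow> nat" where
  "d_T n T = cr_degree {1..n} (map (S_diag n) (sorted_list_of_set T))"

definition edge_of :: "nat \<Rightarrow> (nat \<times> nat) set \<Rightarrow> nat \<Rightarrow> nat \<Rightarrow> bool" where
  "edge_of n T u v = (is_side n u v \<or> (u, v) \<in> T)"

definition triangles :: "nat \<Rightarrow> (nat \<times> nat) set \<Rightarrow> (nat \<times> nat \<times> nat) set" where
  "triangles n T = {(a, b, c). 1 \<le> a \<and> a < b \<and> b < c \<and> c \<le> n \<and>
      edge_of n T a b \<and> edge_of n T b c \<and> edge_of n T a c}"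

definition interior_triangles :: "nat \<Rightarrow> (nat \<times> nat) set \<Rightarrow> nat" where
  "interior_triangles n T = card {(a, b, c) \<in> triangles n T.
      \<not> is_side n a b \<and> \<not> is_side n b c \<and> \<not> is_side n a c}"

end

(* Orient each vertex v of the polygon as the ordered pair (x_v, x_(v+1)) of the points of its two
edges, so that a diagonal prescribes the cross-ratio of the pairs at its ends.  Put x_1 at infinity,
x_2 at 0 and x_n at 1, and build up the configuration from the side {1, n} inwards, triangle by
triangle.  Given the pairs at two vertices of a triangle, the pair at the third satisfies two equations.
If a side of the triangle is an edge of the polygon, one of its points is already known (or, at the
root, the system becomes linear) and the solution is unique; for an interior triangle the system is a
quadratic equation with generically nonzero discriminant.  Hence there are 2^I solutions.

They could still be degenerate, with coinciding points x_i = x_j.  Degenerate solutions depend on n - 4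
parameters, so the n - 3 cross-ratios are algebraically dependent on them, and a general point of the
target has none. *)

theory Submission
  imports Defs "HOL-Computational_Algebra.Polynomial" "HOL-Library.FuncSet"
begin

text \<open>The recursion sees only the pairs at the vertices, so what it counts exactly are weak
  solutions, in which only cyclically consecutive points must differ. This is just strong enough.
  With a prescribed ratio other than 0 it forces the four points of a diagonal apart, so the next
  triangle starts from distinct known points; and it keeps the denominators of the cross-ratios
  nonzero on degenerate solutions, where they are therefore rational functions of the parameters.
  The number of choices at a triangle must not depend on the pairs found so far. In a coordinate
  that puts one known pair at 0 and infinity, the discriminant is a nonzero square times
  \<open>tri_disc\<close>, a polynomial in the three prescribed ratios alone, so one generic
  condition per interior triangle serves all branches. Across the side {1, n} no ratio is
  prescribed, but x_(n+1) = x_1. There the quadratic has the root at which the new pair collapses;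
  dividing it out leaves the linear equation.\<close>

section \<open>Generic points\<close>

text \<open>Same notion of a general point as in \<open>cr_degree\<close>, except that
  \<open>y\<close> is not confined to \<open>cr_target\<close>; where needed, that restriction is
  carried as an implication inside \<open>Q\<close>. In this form finitely many conditions can be
  intersected freely.\<close>

definition generic :: "nat \<Rightarrow> ((nat \<Rightarrow> complex) \<Rightarrow> bool) \<Rightarrow> bool" where
  "generic k Q \<longleftrightarrow> (\<exists>p. poly_fun k p \<and> (\<exists>y. p y \<noteq> 0) \<and> (\<forall>y. p y \<noteq> 0 \<longrightarrow> Q y))"

text \<open>Restriction to a line turns questions about zero sets in several variables into
  questions about univariate polynomials.\<close>

lemma poly_fun_line:
  assumes "poly_fun k p"
  shows "\<exists>q. \<forall>z. p (\<lambda>i. a i + z * b i) = poly q z"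
  using assms
proof induction
  case (pf_const c)
  show ?case by (rule exI[of _ "[:c:]"]) simp
next
  case (pf_var i)
  show ?case by (rule exI[of _ "[:a i, b i:]"]) simp
next
  case (pf_add p q)
  then show ?case by (metis poly_add)
next
  case (pf_mult p q)
  then show ?case by (metis poly_mult)
qed

lemma poly_fun_uminus: "poly_fun k p \<Longrightarrow> poly_fun k (\<lambda>y. - p y)"
  using pf_mult[OF pf_const[of k "-1"], of p] by simp

lemma poly_fun_diff: "poly_fun k p \<Longrightarrow> poly_fun k q \<Longrightarrow> poly_fun k (\<lambda>y. p y - q y)"
  using pf_add[OF _ poly_fun_uminus, of k p q] by simp

lemma poly_fun_power: "poly_fun k p \<Longrightarrow> poly_fun k (\<lambda>y. p y ^ m)"
  by (induction m) (auto intro: pf_const pf_mult)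

lemma poly_fun_prod:
  "finite A \<Longrightarrow> (\<And>a. a \<in> A \<Longrightarrow> poly_fun k (p a)) \<Longrightarrow> poly_fun k (\<lambda>y. \<Prod>a\<in>A. p a y)"
  by (induction A rule: finite_induct) (auto intro: pf_const pf_mult)

lemma poly_fun_sum:
  "finite A \<Longrightarrow> (\<And>a. a \<in> A \<Longrightarrow> poly_fun k (p a)) \<Longrightarrow> poly_fun k (\<lambda>y. \<Sum>a\<in>A. p a y)"
  by (induction A rule: finite_induct) (auto intro: pf_const pf_add)

lemmas poly_fun_intros = pf_const pf_var pf_add pf_mult poly_fun_uminus poly_fun_diff poly_fun_power

lemma genericI: "poly_fun k p \<Longrightarrow> p y0 \<noteq> 0 \<Longrightarrow> (\<And>y. p y \<noteq> 0 \<Longrightarrow> Q y) \<Longrightarrow> generic k Q"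
  unfolding generic_def by blast

lemma generic_mono: "generic k Q \<Longrightarrow> (\<And>y. Q y \<Longrightarrow> R y) \<Longrightarrow> generic k R"
  unfolding generic_def by blast

lemma generic_True: "generic k (\<lambda>y. True)"
  by (rule genericI[of k "\<lambda>y. 1"]) (auto intro: pf_const)

lemma generic_ex: "generic k Q \<Longrightarrow> \<exists>y. Q y"
  unfolding generic_def by blast

lemma generic_conj:
  assumes "generic k Q" "generic k R"
  shows "generic k (\<lambda>y. Q y \<and> R y)"
proof -
  obtain p a where p: "poly_fun k p" "p a \<noteq> 0" "\<And>y. p y \<noteq> 0 \<Longrightarrow> Q y"
    using assms(1) unfolding generic_def by blast
  obtain q b where q: "poly_fun k q" "q b \<noteq> 0" "\<And>y. q y \<noteq> 0 \<Longrightarrow> R y"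
    using assms(2) unfolding generic_def by blast
  \<comment> \<open>On the line through a and b both become nonzero univariate polynomials.\<close>
  obtain f where f: "\<And>z. p (\<lambda>i. a i + z * (b i - a i)) = poly f z"
    using poly_fun_line[OF p(1), of a "\<lambda>i. b i - a i"] by blast
  obtain g where g: "\<And>z. q (\<lambda>i. a i + z * (b i - a i)) = poly g z"
    using poly_fun_line[OF q(1), of a "\<lambda>i. b i - a i"] by blast
  have "poly f 0 \<noteq> 0" "poly g 1 \<noteq> 0"
    using p(2) q(2) f[of 0] g[of 1] by simp_all
  then have "f * g \<noteq> 0" by auto
  then obtain z where "poly (f * g) z \<noteq> 0"
    using poly_all_0_iff_0 by blast
  then have "p (\<lambda>i. a i + z * (b i - a i)) * q (\<lambda>i. a i + z * (b i - a i)) \<noteq> 0"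
    by (simp add: f g)
  then show ?thesis
    using p q by (intro genericI[OF pf_mult[OF p(1) q(1)]]) auto
qed

lemma generic_ball:
  "finite A \<Longrightarrow> (\<And>a. a \<in> A \<Longrightarrow> generic k (Q a)) \<Longrightarrow> generic k (\<lambda>y. \<forall>a\<in>A. Q a y)"
  by (induction A rule: finite_induct) (auto intro: generic_True generic_conj)

lemma generic_cr_target: "generic k (\<lambda>y. y \<in> cr_target k)"
proof -
  have "generic k (\<lambda>y. \<forall>j\<in>{..<k}. y j \<noteq> 0 \<and> y j \<noteq> 1)"
  proof (rule generic_ball)
    fix j assume "j \<in> {..<k}"
    then show "generic k (\<lambda>y. y j \<noteq> 0 \<and> y j \<noteq> 1)"
      by (intro genericI[of k "\<lambda>y. y j * (y j - 1)" "\<lambda>_. 2"] poly_fun_intros) auto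
  qed auto
  then show ?thesis by (rule generic_mono) (auto simp: cr_target_def)
qed

text \<open>The description by \<open>THE\<close> is unambiguous because two general values of the
  fibre cardinality and membership in \<open>cr_target\<close> are generic conditions, hence hold
  together at some point.\<close>

lemma cr_degree_eqI:
  assumes "length V + 3 = card A"
    and "generic (length V) (\<lambda>y. y \<in> cr_target (length V) \<longrightarrow> card (cr_fiber A V y) = d)"
  shows "cr_degree A V = d"
proof -
  let ?k = "length V"
  have "(THE d. \<exists>p. poly_fun ?k p \<and> (\<exists>y. p y \<noteq> 0) \<and>
        (\<forall>y\<in>cr_target ?k. p y \<noteq> 0 \<longrightarrow> card (cr_fiber A V y) = d)) = d"
  proof (rule the_equality)
    show "\<exists>p. poly_fun ?k p \<and> (\<exists>y. p y \<noteq> 0) \<and>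
        (\<forall>y\<in>cr_target ?k. p y \<noteq> 0 \<longrightarrow> card (cr_fiber A V y) = d)"
      using assms(2) unfolding generic_def by blast
  next
    fix d' assume "\<exists>p. poly_fun ?k p \<and> (\<exists>y. p y \<noteq> 0) \<and>
        (\<forall>y\<in>cr_target ?k. p y \<noteq> 0 \<longrightarrow> card (cr_fiber A V y) = d')"
    then have "generic ?k (\<lambda>y. y \<in> cr_target ?k \<longrightarrow> card (cr_fiber A V y) = d')"
      unfolding generic_def by blast
    from generic_ex[OF generic_conj[OF generic_cr_target generic_conj[OF this assms(2)]]]
    show "d' = d" by auto
  qed
  then show ?thesis using assms(1) by (simp add: cr_degree_def)
qed

section \<open>Polynomial dependence by counting on a grid\<close>

definition deg_le :: "nat set \<Rightarrow> nat \<Rightarrow> ((nat \<Rightarrow> complex) \<Rightarrow> complex) \<Rightarrow> bool" where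
  "deg_le I L f \<longleftrightarrow> (\<forall>i\<in>I. \<forall>t. \<exists>q. degree q \<le> L \<and> (\<forall>z. f (t(i := z)) = poly q z))"

lemma deg_le_const: "deg_le I L (\<lambda>t. c)"
  unfolding deg_le_def by (intro ballI allI exI[of _ "[:c:]"]) simp

lemma deg_le_var: "deg_le I 1 (\<lambda>t. t j)"
  unfolding deg_le_def
proof (intro ballI allI)
  fix i :: nat and t :: "nat \<Rightarrow> complex"
  show "\<exists>q. degree q \<le> 1 \<and> (\<forall>z. (t(i := z)) j = poly q z)"
    by (rule exI[of _ "if i = j then [:0, 1:] else [:t j:] :: complex poly"]) simp
qed

lemma deg_le_add:
  assumes "deg_le I L f" "deg_le I L g" shows "deg_le I L (\<lambda>t. f t + g t)"
  unfolding deg_le_def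
proof (intro ballI allI)
  fix i t assume "i \<in> I"
  with assms obtain p q where "degree p \<le> L" "\<And>z. f (t(i := z)) = poly p z"
     "degree q \<le> L" "\<And>z. g (t(i := z)) = poly q z"
    unfolding deg_le_def by metis
  then show "\<exists>r. degree r \<le> L \<and> (\<forall>z. f (t(i := z)) + g (t(i := z)) = poly r z)"
    by (intro exI[of _ "p + q"]) (auto intro: degree_add_le)
qed

lemma deg_le_mult:
  assumes "deg_le I L f" "deg_le I M g" shows "deg_le I (L + M) (\<lambda>t. f t * g t)"
  unfolding deg_le_def
proof (intro ballI allI)
  fix i t assume "i \<in> I"
  with assms obtain p q where "degree p \<le> L" "\<And>z. f (t(i := z)) = poly p z"
     "degree q \<le> M" "\<And>z. g (t(i := z)) = poly q z"
    unfolding deg_le_def by metis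
  then show "\<exists>r. degree r \<le> L + M \<and> (\<forall>z. f (t(i := z)) * g (t(i := z)) = poly r z)"
    using degree_mult_le[of p q] by (intro exI[of _ "p * q"]) auto
qed

lemma deg_le_diff:
  assumes "deg_le I L f" "deg_le I L g" shows "deg_le I L (\<lambda>t. f t - g t)"
  using deg_le_add[OF assms(1), of "\<lambda>t. (-1) * g t"]
    deg_le_mult[OF deg_le_const[of I 0 "-1"] assms(2)] by simp

lemma deg_le_power: "deg_le I L f \<Longrightarrow> deg_le I (m * L) (\<lambda>t. f t ^ m)"
  by (induction m) (auto intro: deg_le_const deg_le_mult)

lemma deg_le_sum:
  "finite A \<Longrightarrow> (\<And>a. a \<in> A \<Longrightarrow> deg_le I L (f a)) \<Longrightarrow> deg_le I L (\<lambda>t. \<Sum>a\<in>A. f a t)"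
  by (induction A rule: finite_induct) (auto intro: deg_le_const deg_le_add)

lemma deg_le_prod:
  "finite A \<Longrightarrow> (\<And>a. a \<in> A \<Longrightarrow> deg_le I L (f a)) \<Longrightarrow> deg_le I (card A * L) (\<lambda>t. \<Prod>a\<in>A. f a t)"
  by (induction A rule: finite_induct) (auto intro: deg_le_const deg_le_mult)

definition grid :: "nat set \<Rightarrow> nat \<Rightarrow> (nat \<Rightarrow> complex) set" where
  "grid I L = {t. (\<forall>i\<in>I. t i \<in> of_nat ` {..L}) \<and> (\<forall>i. i \<notin> I \<longrightarrow> t i = 0)}"

lemma card_grid:
  assumes "finite I"
  shows "finite (grid I L)" "card (grid I L) \<le> Suc L ^ card I"
proof -
  let ?S = "I \<rightarrow>\<^sub>E (of_nat ` {..L} :: complex set)"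
  have sub: "grid I L \<subseteq> (\<lambda>f i. if i \<in> I then f i else 0) ` ?S"
  proof
    fix t assume t: "t \<in> grid I L"
    show "t \<in> (\<lambda>f i. if i \<in> I then f i else 0) ` ?S"
      by (rule image_eqI[of _ _ "restrict t I"]) (use t in \<open>auto simp: grid_def fun_eq_iff\<close>)
  qed
  have fin: "finite ?S" using assms by (intro finite_PiE) auto
  show "finite (grid I L)" using finite_subset[OF sub] fin by blast
  have "card (grid I L) \<le> card ?S"
    using card_mono[OF finite_imageI[OF fin] sub] card_image_le[OF fin] le_trans by blast
  also have "\<dots> = Suc L ^ card I"
    using assms by (simp add: card_PiE card_image inj_on_def)
  finally show "card (grid I L) \<le> Suc L ^ card I" .
qed

text \<open>\<open>deg_le\<close> bounds the degree in each variable separately, and the grid offers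
  \<open>L + 1\<close> values per coordinate, one more than the number of roots allowed.\<close>

lemma deg_le_grid_zero:
  assumes "finite I" and f: "deg_le I L f" and z: "\<And>t. t \<in> grid I L \<Longrightarrow> f t = 0"
    and t: "\<And>i. i \<notin> I \<Longrightarrow> t i = 0"
  shows "f t = 0"
proof -
  \<comment> \<open>\<open>J\<close> is the set of coordinates already released from the grid; the
    induction releases one at a time.\<close>
  have "f t = 0" if "J \<subseteq> I" "\<forall>i\<in>I - J. t i \<in> of_nat ` {..L}" "\<forall>i. i \<notin> I \<longrightarrow> t i = 0" for J t
    using finite_subset[OF that(1) assms(1)] that
  proof (induction J arbitrary: t rule: finite_induct)
    case empty
    then show ?case by (intro z) (auto simp: grid_def)
  next
    case (insert j J)
    then obtain q where q: "degree q \<le> L" "\<And>z. f (t(j := z)) = poly q z"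
      using f unfolding deg_le_def by (meson insert_subset)
    have "poly q z = 0" if "z \<in> of_nat ` {..L}" for z
    proof -
      have "f (t(j := z)) = 0"
        using insert that by (intro insert.IH) auto
      then show ?thesis by (simp add: q)
    qed
    moreover have "card (of_nat ` {..L} :: complex set) = Suc L"
      by (simp add: card_image inj_on_def)
    ultimately have "q = 0"
      using q(1) by (intro poly_eqI_degree[where A = "of_nat ` {..L} :: complex set"]) auto
    then show ?case using q(2)[of "t j"] by simp
  qed
  from this[of I t] show ?thesis using t by simp
qed

text \<open>Gaussian elimination: equation \<open>g\<close> is solved for the coefficient of a pivot
  \<open>e0\<close> and substituted into the remaining equations, which loses one equation and one
  unknown.\<close>

lemma underdetermined_system:
  fixes a :: "'a \<Rightarrow> 'b \<Rightarrow> complex"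
  assumes "finite G" "finite E" "card G < card E"
  shows "\<exists>c. (\<exists>e\<in>E. c e \<noteq> 0) \<and> (\<forall>g\<in>G. (\<Sum>e\<in>E. c e * a e g) = 0)"
  using assms
proof (induction G arbitrary: E a rule: finite_induct)
  case empty
  then have "E \<noteq> {}" by auto
  then show ?case by (intro exI[of _ "\<lambda>_. 1"]) auto
next
  case (insert g G)
  show ?case
  proof (cases "\<forall>e\<in>E. a e g = 0")
    case True
    obtain c where "\<exists>e\<in>E. c e \<noteq> 0" "\<forall>h\<in>G. (\<Sum>e\<in>E. c e * a e h) = 0"
      using insert.IH[of E a] insert.prems insert.hyps by auto
    with True show ?thesis by (intro exI[of _ c]) auto
  next
    case False
    then obtain e0 where e0: "e0 \<in> E" "a e0 g \<noteq> 0" by blast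
    let ?E = "E - {e0}"
    have "card G < card ?E" using insert.prems insert.hyps e0 by auto
    then obtain c where c: "\<exists>e\<in>?E. c e \<noteq> 0"
      "\<And>h. h \<in> G \<Longrightarrow> (\<Sum>e\<in>?E. c e * (a e h - a e g / a e0 g * a e0 h)) = 0"
      using insert.IH[of ?E "\<lambda>e h. a e h - a e g / a e0 g * a e0 h"] insert.prems by auto
    let ?s = "\<lambda>h. \<Sum>e\<in>?E. c e * a e h"
    let ?c = "c(e0 := - ?s g / a e0 g)"
    have sum: "(\<Sum>e\<in>E. ?c e * a e h) = - ?s g / a e0 g * a e0 h + ?s h" for h
      using e0 insert.prems by (simp add: sum.remove[of E e0])
    have "?s h = ?s g / a e0 g * a e0 h" if "h \<in> G" for h
    proof -
      have "(\<Sum>e\<in>?E. c e * (a e h - a e g / a e0 g * a e0 h)) = ?s h - (\<Sum>e\<in>?E. c e * a e g / a e0 g * a e0 h)"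
        by (simp add: sum_subtractf[symmetric] algebra_simps)
      also have "(\<Sum>e\<in>?E. c e * a e g / a e0 g * a e0 h) = ?s g / a e0 g * a e0 h"
        by (simp add: sum_distrib_right sum_divide_distrib)
      finally show ?thesis using c(2)[OF that] by simp
    qed
    then have "\<forall>h\<in>insert g G. (\<Sum>e\<in>E. ?c e * a e h) = 0"
      unfolding sum using e0 by simp
    moreover have "\<exists>e\<in>E. ?c e \<noteq> 0" using c(1) by auto
    ultimately show ?thesis by blast
  qed
qed

lemma digit_sum: "(\<Sum>j<k. (e div B ^ j mod B) * B ^ j) = e mod B ^ k" for e B :: nat
proof (induction k)
  case (Suc k)
  have "e mod B ^ Suc k = B ^ k * (e div B ^ k mod B) + e mod B ^ k"
    by (metis mod_mult2_eq power_Suc2)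
  with Suc show ?case by (simp add: mult.commute)
qed simp

text \<open>Algebraic dependence by counting: after clearing denominators there are more monomials of
bounded degree than points of a grid on which their combinations have to vanish.\<close>

lemma generic_not_in_image:
  assumes I: "finite I" "card I < k" and "1 \<le> L"
    and N: "\<And>j. j < k \<Longrightarrow> deg_le I L (N j)" and D: "\<And>j. j < k \<Longrightarrow> deg_le I L (D j)"
  shows "generic k (\<lambda>y. \<not> (\<exists>t. (\<forall>i. i \<notin> I \<longrightarrow> t i = 0) \<and>
           (\<forall>j<k. D j t \<noteq> 0 \<and> N j t = y j * D j t)))"
proof -
  define m where "m = card I"
  \<comment> \<open>Exponents run up to \<open>d\<close>, which gives \<open>B ^ k\<close>
    monomials. The grid has at most \<open>(1 + k * d * L) ^ m\<close> points, which is at most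
    \<open>(k * L * B) ^ m = d * B ^ m\<close>. The choice of \<open>d\<close> makes this smaller
    than \<open>B ^ (m + 1)\<close>, hence than \<open>B ^ k\<close>.\<close>
  define d where "d = (k * L) ^ m"
  define B where "B = Suc d"
  define dig where "dig e j = e div B ^ j mod B" for e j
  \<comment> \<open>The monomial with exponents \<open>dig e j\<close> in the quotients
    \<open>N j / D j\<close>, multiplied by every \<open>D j ^ d\<close>. The common factor is the
    same for all \<open>e\<close>, so linear relations among the \<open>trm e\<close> become
    relations among the monomials.\<close>
  define trm where "trm e t = (\<Prod>j<k. N j t ^ dig e j * D j t ^ (d - dig e j))" for e t
  have dig: "dig e j \<le> d" for e j
    using mod_less_divisor[of B "e div B ^ j"] unfolding dig_def B_def by linarith
  have deg: "deg_le I (k * (d * L)) (trm e)" for e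
  proof -
    have "deg_le I (dig e j * L + (d - dig e j) * L) (\<lambda>t. N j t ^ dig e j * D j t ^ (d - dig e j))"
      if "j < k" for j
      by (intro deg_le_mult deg_le_power N D that)
    moreover have "dig e j * L + (d - dig e j) * L = d * L" for j
      using dig[of e j] by (metis add_mult_distrib le_add_diff_inverse)
    ultimately show ?thesis
      using deg_le_prod[of "{..<k}" I "d * L" "\<lambda>j t. N j t ^ dig e j * D j t ^ (d - dig e j)"]
      unfolding trm_def by simp
  qed
  have "card (grid I (k * (d * L))) \<le> Suc (k * (d * L)) ^ m"
    unfolding m_def by (rule card_grid(2)[OF I(1)])
  also have "Suc (k * (d * L)) \<le> k * L * B"
  proof -
    have "1 \<le> k * L" using assms(3) I(2) by (simp add: Suc_le_eq)
    then show ?thesis by (simp add: B_def algebra_simps)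
  qed
  then have "Suc (k * (d * L)) ^ m \<le> (k * L * B) ^ m" by (rule power_mono) simp
  also have "\<dots> = d * B ^ m" by (simp add: d_def power_mult_distrib)
  also have "\<dots> < B * B ^ m" by (simp add: B_def)
  also have "\<dots> = B ^ Suc m" by simp
  also have "\<dots> \<le> B ^ k" using I(2) unfolding m_def B_def by (intro power_increasing) auto
  finally have "card (grid I (k * (d * L))) < card {..<B ^ k}" by simp
  from underdetermined_system[OF card_grid(1)[OF I(1)] _ this, of "\<lambda>e t. trm e t"]
  obtain c where c: "\<exists>e<B ^ k. c e \<noteq> 0"
    and van: "\<And>t. t \<in> grid I (k * (d * L)) \<Longrightarrow> (\<Sum>e<B ^ k. c e * trm e t) = 0"
    by auto
  define P where "P y = (\<Sum>e<B ^ k. c e * (\<Prod>j<k. y j ^ dig e j))" for y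
  show ?thesis
  proof (rule generic_mono)
    \<comment> \<open>Kronecker substitution: base B digits keep the monomials apart.\<close>
    define q where "q = (\<Sum>e<B ^ k. monom (c e) e)"
    have "coeff q e = (if e < B ^ k then c e else 0)" for e
      by (simp add: q_def coeff_sum)
    then have "q \<noteq> 0" using c by (metis coeff_0)
    then obtain z where z: "poly q z \<noteq> 0" using poly_all_0_iff_0 by blast
    have "(\<Prod>j<k. (z ^ (B ^ j)) ^ dig e j) = z ^ e" if "e < B ^ k" for e
    proof -
      have "(\<Prod>j<k. (z ^ (B ^ j)) ^ dig e j) = z ^ (\<Sum>j<k. dig e j * B ^ j)"
        by (simp add: power_sum power_mult[symmetric] mult.commute)
      then show ?thesis using that by (simp add: dig_def digit_sum)
    qed
    then have "P (\<lambda>j. z ^ (B ^ j)) = poly q z"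
      by (simp add: P_def q_def poly_sum poly_monom)
    moreover have "poly_fun k P"
      unfolding P_def by (intro poly_fun_sum poly_fun_prod poly_fun_intros) auto
    ultimately show "generic k (\<lambda>y. P y \<noteq> 0)"
      using z by (intro genericI[of k P "\<lambda>j. z ^ (B ^ j)"]) auto
  next
    fix y assume "P y \<noteq> 0"
    show "\<not> (\<exists>t. (\<forall>i. i \<notin> I \<longrightarrow> t i = 0) \<and> (\<forall>j<k. D j t \<noteq> 0 \<and> N j t = y j * D j t))"
    proof
      assume "\<exists>t. (\<forall>i. i \<notin> I \<longrightarrow> t i = 0) \<and> (\<forall>j<k. D j t \<noteq> 0 \<and> N j t = y j * D j t)"
      then obtain t where t: "\<And>i. i \<notin> I \<Longrightarrow> t i = 0"
        "\<And>j. j < k \<Longrightarrow> D j t \<noteq> 0" "\<And>j. j < k \<Longrightarrow> N j t = y j * D j t" by blast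
      have trm: "trm e t = (\<Prod>j<k. y j ^ dig e j) * (\<Prod>j<k. D j t ^ d)" for e
      proof -
        have "trm e t = (\<Prod>j<k. y j ^ dig e j * D j t ^ d)"
          unfolding trm_def
        proof (rule prod.cong)
          fix j assume "j \<in> {..<k}"
          then have "N j t ^ dig e j * D j t ^ (d - dig e j)
              = y j ^ dig e j * (D j t ^ dig e j * D j t ^ (d - dig e j))"
            by (simp add: t(3) power_mult_distrib)
          also have "D j t ^ dig e j * D j t ^ (d - dig e j) = D j t ^ d"
            using dig[of e j] by (simp flip: power_add)
          finally show "N j t ^ dig e j * D j t ^ (d - dig e j) = y j ^ dig e j * D j t ^ d" .
        qed simp
        then show ?thesis by (simp add: prod.distrib)
      qed
      have "(\<Sum>e<B ^ k. c e * trm e t) = 0"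
        by (rule deg_le_grid_zero[OF I(1) _ van t(1)])
           (auto intro!: deg_le_sum deg_le_mult[OF deg_le_const[of I 0], simplified] deg)
      then have "P y * (\<Prod>j<k. D j t ^ d) = 0"
        by (simp add: P_def trm sum_distrib_right mult.assoc)
      with \<open>P y \<noteq> 0\<close> show False using t(2) by simp
    qed
  qed
qed

section \<open>Points of the projective line and one step across a triangle\<close>

text \<open>Each point of the projective line is represented by one normalised coordinate vector.\<close>

definition PP :: "(complex \<times> complex) set" where
  "PP = insert (1, 0) (range (\<lambda>t. (t, 1)))"

text \<open>Homogeneous form of the difference of two points, so that infinity needs no separate
  treatment.\<close>

definition br :: "complex \<times> complex \<Rightarrow> complex \<times> complex \<Rightarrow> complex" where
  "br X Y = fst X * snd Y - snd X * fst Y"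

text \<open>The equation "cross-ratio equals \<open>e\<close>" with its denominator cleared; it
  stays meaningful when points coincide.\<close>

definition crel :: "complex \<Rightarrow> complex \<times> complex \<Rightarrow> complex \<times> complex \<Rightarrow> complex \<times> complex \<Rightarrow>
    complex \<times> complex \<Rightarrow> bool" where
  "crel e X Y Z W \<longleftrightarrow> br X Z * br Y W = e * (br X W * br Y Z)"

lemma br_self [simp]: "br X X = 0"
  by (simp add: br_def)

lemma br_swap: "br X Y = - br Y X"
  by (simp add: br_def)

lemma br_eq_0_iff: "X \<in> PP \<Longrightarrow> Y \<in> PP \<Longrightarrow> br X Y = 0 \<longleftrightarrow> X = Y"
  by (auto simp: PP_def br_def)

lemma br_nonzero: "X \<in> PP \<Longrightarrow> Y \<in> PP \<Longrightarrow> X \<noteq> Y \<Longrightarrow> br X Y \<noteq> 0"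
  by (simp add: br_eq_0_iff)

text \<open>The three-term relation among 2 by 2 minors. It yields the coordinate formula
  \<open>br_pt\<close> and the change of cross-ratio under a rotation of its arguments.\<close>

lemma plucker: "br X V * br U W = br U X * br W V - br U V * br W X"
  by (simp add: br_def algebra_simps)

text \<open>The equation says that \<open>X\<close> is proportional to \<open>U - c W\<close>, a
  nonzero vector because \<open>U\<close> and \<open>W\<close> are independent.\<close>

lemma ex1_coordinate:
  assumes "U \<in> PP" "W \<in> PP" "U \<noteq> W"
  shows "\<exists>!X. X \<in> PP \<and> br U X = c * br W X"
proof -
  define Z where "Z = (fst U - c * fst W, snd U - c * snd W)"
  have Z: "br U X = c * br W X \<longleftrightarrow> fst Z * snd X = snd Z * fst X" for X
    by (auto simp: Z_def br_def algebra_simps)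
  have "Z \<noteq> (0, 0)"
  proof
    assume "Z = (0, 0)"
    then have "fst U = c * fst W" "snd U = c * snd W" by (simp_all add: Z_def)
    then have "br U W = 0" by (simp add: br_def)
    with assms show False by (simp add: br_eq_0_iff)
  qed
  show ?thesis
  proof (cases "snd Z = 0")
    case True
    with \<open>Z \<noteq> (0, 0)\<close> have "fst Z \<noteq> 0" by (cases Z) auto
    with True show ?thesis
      unfolding Z by (intro ex1I[of _ "(1, 0)"]) (auto simp: PP_def)
  next
    case False
    then show ?thesis
      unfolding Z by (intro ex1I[of _ "(fst Z / snd Z, 1)"]) (auto simp: PP_def field_simps)
  qed
qed

text \<open>The degenerate solutions of the cross-ratio equation have three coinciding points.\<close>

lemma crel_distinct:
  assumes "crel e X Y Z W" "e \<noteq> 0" "X \<in> PP" "Y \<in> PP" "Z \<in> PP" "W \<in> PP" "X \<noteq> Y" "Z \<noteq> W"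
  shows "X \<noteq> Z" "X \<noteq> W" "Y \<noteq> Z" "Y \<noteq> W"
  using assms by (auto simp: crel_def br_eq_0_iff)

lemma quadratic_roots:
  fixes a b c :: complex
  assumes "a \<noteq> 0" "b ^ 2 - 4 * a * c \<noteq> 0"
  shows "\<exists>r s. r \<noteq> s \<and> (\<forall>x. a * x ^ 2 + b * x + c = 0 \<longleftrightarrow> x = r \<or> x = s)"
proof -
  define d where "d = csqrt (b ^ 2 - 4 * a * c)"
  have d: "d ^ 2 = b ^ 2 - 4 * a * c" "d \<noteq> 0" using assms(2) by (auto simp: d_def)
  have "a * x ^ 2 + b * x + c = 0 \<longleftrightarrow> x = (- b + d) / (2 * a) \<or> x = (- b - d) / (2 * a)" for x
  proof -
    have "4 * a * (a * x ^ 2 + b * x + c) = (2 * a * x + b) ^ 2 - d ^ 2"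
      unfolding d by (simp add: power2_eq_square algebra_simps)
    then have "a * x ^ 2 + b * x + c = 0 \<longleftrightarrow> (2 * a * x + b) ^ 2 - d ^ 2 = 0"
      using assms(1) by (metis mult_eq_0_iff zero_neq_numeral)
    also have "(2 * a * x + b) ^ 2 - d ^ 2 = (2 * a * x + b - d) * (2 * a * x + b + d)"
      by (simp add: power2_eq_square algebra_simps)
    also have "\<dots> = 0 \<longleftrightarrow> x = (- b + d) / (2 * a) \<or> x = (- b - d) / (2 * a)"
    proof -
      have "2 * a * x + b - d = 0 \<longleftrightarrow> x = (- b + d) / (2 * a)"
        "2 * a * x + b + d = 0 \<longleftrightarrow> x = (- b - d) / (2 * a)"
        using assms(1) by (auto simp: field_simps add_eq_0_iff)
      then show ?thesis by simp
    qed
    finally show ?thesis .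
  qed
  moreover have "(- b + d) / (2 * a) \<noteq> (- b - d) / (2 * a)"
    using d(2) assms(1) by (auto simp: divide_simps)
  ultimately show ?thesis by blast
qed

text \<open>(X, Y) is the pair at the third vertex of a triangle with the pairs (U, U') and (V, V') at
the other two.  Adjacent vertices share a point.\<close>

lemma card_third_vertex_left:
  assumes P: "U' \<in> PP" "V \<in> PP" "V' \<in> PP" and ne: "U' \<noteq> V" "U' \<noteq> V'" "V \<noteq> V'" and b: "b \<noteq> 1"
  shows "card {(X, Y) \<in> PP \<times> PP. X \<noteq> Y \<and> U' = X \<and> crel b X Y V V'} = 1"
proof -
  have nz: "br U' V \<noteq> 0" "br U' V' \<noteq> 0" using P ne by (simp_all add: br_eq_0_iff)
  have eq: "crel b U' Y V V' \<longleftrightarrow> br V' Y = b * br U' V' / br U' V * br V Y" for Y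
  proof -
    have "crel b U' Y V V' \<longleftrightarrow> br V' Y * br U' V = (b * br U' V') * br V Y"
      unfolding crel_def br_swap[of Y V] br_swap[of Y V'] by (simp add: mult_ac)
    also have "\<dots> \<longleftrightarrow> br V' Y = (b * br U' V') * br V Y / br U' V"
      using nz by (subst eq_divide_eq) simp
    finally show ?thesis by simp
  qed
  obtain Y where Y: "Y \<in> PP" "br V' Y = b * br U' V' / br U' V * br V Y"
    "\<And>Z. Z \<in> PP \<Longrightarrow> br V' Z = b * br U' V' / br U' V * br V Z \<Longrightarrow> Z = Y"
    using ex1_coordinate[of V' V] P ne by metis
  \<comment> \<open>\<open>Y = U'\<close> would give ratio 1, so the unique solution automatically
    satisfies \<open>X \<noteq> Y\<close>.\<close>
  have "\<not> crel b U' U' V V'"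
    using nz b by (simp add: crel_def)
  then have "Z \<in> PP \<and> U' \<noteq> Z \<and> crel b U' Z V V' \<longleftrightarrow> Z = Y" for Z
    using Y(1,2) Y(3)[of Z] unfolding eq by metis
  then have "{(X, Y) \<in> PP \<times> PP. X \<noteq> Y \<and> U' = X \<and> crel b X Y V V'} = {(U', Y)}"
    using P(1) by blast
  then show ?thesis by simp
qed

lemma card_third_vertex_right:
  assumes P: "U \<in> PP" "U' \<in> PP" "V \<in> PP" and ne: "U \<noteq> V" "U' \<noteq> V" "U \<noteq> U'" and a: "a \<noteq> 1"
  shows "card {(X, Y) \<in> PP \<times> PP. X \<noteq> Y \<and> crel a U U' X Y \<and> Y = V} = 1"
proof -
  have nz: "br U V \<noteq> 0" "br U' V \<noteq> 0" using P ne by (simp_all add: br_eq_0_iff)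
  have eq: "crel a U U' X V \<longleftrightarrow> br U X = a * br U V / br U' V * br U' X" for X
  proof -
    have "crel a U U' X V \<longleftrightarrow> br U X * br U' V = (a * br U V) * br U' X"
      unfolding crel_def by (simp add: mult.assoc)
    also have "\<dots> \<longleftrightarrow> br U X = (a * br U V) * br U' X / br U' V"
      using nz by (subst eq_divide_eq) simp
    finally show ?thesis by simp
  qed
  obtain X where X: "X \<in> PP" "br U X = a * br U V / br U' V * br U' X"
    "\<And>Z. Z \<in> PP \<Longrightarrow> br U Z = a * br U V / br U' V * br U' Z \<Longrightarrow> Z = X"
    using ex1_coordinate[of U U'] P ne by metis
  have "\<not> crel a U U' V V"
    using nz a by (simp add: crel_def)
  then have "Z \<in> PP \<and> Z \<noteq> V \<and> crel a U U' Z V \<longleftrightarrow> Z = X" for Z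
    using X(1,2) X(3)[of Z] unfolding eq by metis
  then have "{(X, Y) \<in> PP \<times> PP. X \<noteq> Y \<and> crel a U U' X Y \<and> Y = V} = {(X, V)}"
    using P(3) by blast
  then show ?thesis by simp
qed

lemma card_third_vertex_both:
  assumes "U' \<in> PP" "V \<in> PP" "U' \<noteq> V"
  shows "card {(X, Y) \<in> PP \<times> PP. X \<noteq> Y \<and> U' = X \<and> Y = V} = 1"
proof -
  have "{(X, Y) \<in> PP \<times> PP. X \<noteq> Y \<and> U' = X \<and> Y = V} = {(U', V)}" using assms by auto
  then show ?thesis by simp
qed

text \<open>The discriminant of the quadratic equation for the third vertex of an interior triangle.\<close>

definition tri_disc :: "complex \<Rightarrow> complex \<Rightarrow> complex \<Rightarrow> complex" where
  "tri_disc a b g = (a + g - b * (1 + a * g)) ^ 2 - 4 * a * g * (1 - b) ^ 2"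

section \<open>A coordinate adapted to a base pair\<close>

context
  fixes U U' :: "complex \<times> complex"
  assumes U: "U \<in> PP" "U' \<in> PP" "U \<noteq> U'"
begin

text \<open>The point with coordinate \<open>c\<close> when \<open>U\<close> is put at 0 and
  \<open>U'\<close> at infinity. Cross-ratio equations involving the base pair become linear: see
  \<open>crel_base_pt\<close>.\<close>

definition pt :: "complex \<Rightarrow> complex \<times> complex" where
  "pt c = (THE X. X \<in> PP \<and> br U X = c * br U' X)"

lemma pt: "pt c \<in> PP" "br U (pt c) = c * br U' (pt c)"
proof -
  have "pt c \<in> PP \<and> br U (pt c) = c * br U' (pt c)"
    unfolding pt_def by (rule theI'[OF ex1_coordinate[OF U]])
  then show "pt c \<in> PP" "br U (pt c) = c * br U' (pt c)" by blast+
qed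

lemma pt_unique:
  assumes "X \<in> PP" "br U X = c * br U' X"
  shows "X = pt c"
  unfolding pt_def by (rule the1_equality[OF ex1_coordinate[OF U], symmetric]) (use assms in blast)

lemma pt_ne: "pt c \<noteq> U'"
proof
  assume "pt c = U'"
  then have "br U U' = c * br U' U'" using pt(2)[of c] by metis
  with br_nonzero[OF U] show False by simp
qed

lemma pt_nonzero: "br U' (pt c) \<noteq> 0"
  by (rule br_nonzero[OF U(2) pt(1) pt_ne[symmetric]])

lemma pt_inj [simp]: "pt c = pt d \<longleftrightarrow> c = d"
proof
  assume "pt c = pt d"
  then have "c * br U' (pt c) = d * br U' (pt c)" using pt(2) by metis
  then show "c = d" using pt_nonzero[of c] by simp
qed simp

lemma pt_surj: "X \<in> PP \<Longrightarrow> X \<noteq> U' \<Longrightarrow> \<exists>c. X = pt c"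
proof -
  assume X: "X \<in> PP" "X \<noteq> U'"
  then have "br U' X \<noteq> 0" using br_nonzero[OF U(2)] by metis
  then have "br U X = br U X / br U' X * br U' X" by simp
  with X(1) show ?thesis by (blast intro: pt_unique)
qed

lemma pt_eq_U: "pt c = U \<longleftrightarrow> c = 0"
proof -
  have "U = pt 0" by (rule pt_unique) (simp_all add: U)
  then have "pt c = U \<longleftrightarrow> pt c = pt 0" by (rule arg_cong)
  then show ?thesis by (simp only: pt_inj)
qed

lemma br_pt: "br (pt c) (pt d) * br U U' = (c - d) * (br U' (pt c) * br U' (pt d))"
  unfolding plucker[of "pt c" "pt d" U U'] pt(2) by (simp only: left_diff_distrib mult_ac)

text \<open>By \<open>br_pt\<close> each bracket is a difference of coordinates up to scale. Every
  point occurs once in each of the two products, so the scale factors form the same \<open>K\<close>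
  on both sides and cancel.\<close>

lemma crel_pt: "crel e (pt x) (pt y) (pt z) (pt w) \<longleftrightarrow> (x - z) * (y - w) = e * ((x - w) * (y - z))"
proof -
  define K where "K = br U' (pt x) * br U' (pt y) * br U' (pt z) * br U' (pt w)"
  have K: "K \<noteq> 0" by (simp add: K_def pt_nonzero)
  have uu: "br U U' \<noteq> 0" by (rule br_nonzero[OF U])
  have "crel e (pt x) (pt y) (pt z) (pt w) \<longleftrightarrow> (br U U' * br U U') * (br (pt x) (pt z) * br (pt y) (pt w)) =
    (br U U' * br U U') * (e * (br (pt x) (pt w) * br (pt y) (pt z)))"
    using uu by (simp only: crel_def mult_cancel_left mult_eq_0_iff) simp
  also have "(br U U' * br U U') * (br (pt x) (pt z) * br (pt y) (pt w))
      = (br (pt x) (pt z) * br U U') * (br (pt y) (pt w) * br U U')"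
    by (simp only: mult_ac)
  also have "\<dots> = K * ((x - z) * (y - w))"
    unfolding br_pt K_def by (simp only: mult_ac)
  also have "(br U U' * br U U') * (e * (br (pt x) (pt w) * br (pt y) (pt z)))
      = e * ((br (pt x) (pt w) * br U U') * (br (pt y) (pt z) * br U U'))"
    by (simp only: mult_ac)
  also have "\<dots> = K * (e * ((x - w) * (y - z)))"
    unfolding br_pt K_def by (simp only: mult_ac)
  finally show ?thesis using K by simp
qed

lemma crel_base_pt: "crel e U U' (pt x) (pt y) \<longleftrightarrow> x = e * y"
  using pt_nonzero[of x] pt_nonzero[of y] by (auto simp: crel_def pt(2))

text \<open>By \<open>crel_distinct\<close> neither point is \<open>U'\<close>, so both have
  coordinates; the parametrisation of the solutions by \<open>y\<close> is therefore
  exhaustive.\<close>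

lemma crel_base_cases:
  assumes "crel a U U' X Y" "X \<in> PP" "Y \<in> PP" "X \<noteq> Y" "a \<noteq> 0"
  shows "\<exists>y. y \<noteq> 0 \<and> X = pt (a * y) \<and> Y = pt y"
proof -
  have "X \<noteq> U'" "Y \<noteq> U'" "Y \<noteq> U"
    using crel_distinct[of a U U' X Y] assms U by auto
  then obtain x y where "X = pt x" "Y = pt y" using pt_surj assms by blast
  with assms(1) \<open>Y \<noteq> U\<close> show ?thesis by (auto simp: crel_base_pt pt_eq_U)
qed

text \<open>The ratio \<open>a\<close> with the base pair gives X the coordinate
  \<open>a * y\<close> when Y has \<open>y\<close>, and likewise \<open>g\<close> gives V and V' the
  coordinates \<open>g * v\<close> and \<open>v\<close>. The ratio \<open>b\<close> then becomes a
  quadratic in \<open>y\<close> with discriminant \<open>tri_disc a b g * v ^ 2\<close>.\<close>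

lemma card_third_vertex_interior:
  assumes P: "V \<in> PP" "V' \<in> PP" "V \<noteq> V'" and g: "crel g U U' V V'"
    and e: "a \<noteq> 0" "a \<noteq> 1" "b \<noteq> 1" "g \<noteq> 0" and disc: "tri_disc a b g \<noteq> 0"
  shows "card {(X, Y) \<in> PP \<times> PP. X \<noteq> Y \<and> crel a U U' X Y \<and> crel b X Y V V'} = 2"
proof -
  obtain v where v: "v \<noteq> 0" "V = pt (g * v)" "V' = pt v" using crel_base_cases[OF g P e(4)] by blast
  define A where "A = a * (1 - b)"
  define B where "B = - (a + g - b * (1 + a * g)) * v"
  define C where "C = g * (1 - b) * v ^ 2"
  have "B ^ 2 - 4 * A * C = tri_disc a b g * v ^ 2"
    by (simp add: A_def B_def C_def tri_disc_def power2_eq_square algebra_simps)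
  moreover have "A \<noteq> 0" using e by (simp add: A_def)
  ultimately obtain r s where rs: "r \<noteq> s" "\<And>x. A * x ^ 2 + B * x + C = 0 \<longleftrightarrow> x = r \<or> x = s"
    using quadratic_roots[of A B C] disc v(1) by auto
  have quad: "crel b (pt (a * y)) (pt y) V V' \<longleftrightarrow> A * y ^ 2 + B * y + C = 0" for y
  proof -
    have "crel b (pt (a * y)) (pt y) V V' \<longleftrightarrow> (a * y - g * v) * (y - v) - b * ((a * y - v) * (y - g * v)) = 0"
      unfolding v crel_pt by simp
    also have "(a * y - g * v) * (y - v) - b * ((a * y - v) * (y - g * v)) = A * y ^ 2 + B * y + C"
      by (simp add: A_def B_def C_def power2_eq_square algebra_simps)
    finally show ?thesis .
  qed
  \<comment> \<open>Keeps both roots away from \<open>y = 0\<close>, where X and Y would both be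
    U.\<close>
  have "C \<noteq> 0" using e v by (simp add: C_def)
  then have nz: "r \<noteq> 0" "s \<noteq> 0" using rs(2)[of 0] by auto
  have "{(X, Y) \<in> PP \<times> PP. X \<noteq> Y \<and> crel a U U' X Y \<and> crel b X Y V V'}
      = (\<lambda>y. (pt (a * y), pt y)) ` {r, s}" (is "?L = ?R")
  proof
    show "?R \<subseteq> ?L" using e nz rs by (auto simp: pt crel_base_pt quad)
    show "?L \<subseteq> ?R"
    proof
      fix p assume "p \<in> ?L"
      then obtain X Y where *: "p = (X, Y)" "X \<in> PP" "Y \<in> PP" "X \<noteq> Y"
        "crel a U U' X Y" "crel b X Y V V'" by blast
      then obtain y where y: "X = pt (a * y)" "Y = pt y" using crel_base_cases e by blast
      with *(6) have "y = r \<or> y = s" by (simp add: quad rs)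
      with y * show "p \<in> ?R" by auto
    qed
  qed
  moreover have "inj_on (\<lambda>y. (pt (a * y), pt y)) {r, s}" by (auto simp: inj_on_def)
  ultimately show ?thesis using rs(1) by (simp add: card_image)
qed

text \<open>Here the second known pair is (V, U), and U has coordinate 0. The quadratic is divisible
  by \<open>y\<close>, whose root is the collapsed pair X = Y = U, and
  \<open>a * b \<noteq> 1\<close> keeps the remaining root away from 0.\<close>

lemma card_third_vertex_root:
  assumes P: "V \<in> PP" "V \<noteq> U" "V \<noteq> U'"
    and e: "a \<noteq> 0" "a \<noteq> 1" "b \<noteq> 1" and ab: "a * b \<noteq> 1"
  shows "card {(X, Y) \<in> PP \<times> PP. X \<noteq> Y \<and> crel a U U' X Y \<and> crel b X Y V U} = 1"
proof -
  obtain v where v: "V = pt v" using pt_surj P by blast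
  have "v \<noteq> 0" using v P pt_eq_U by auto
  define r where "r = v * (1 - a * b) / (a * (1 - b))"
  have "r \<noteq> 0" using \<open>v \<noteq> 0\<close> e ab by (auto simp: r_def)
  have lin: "crel b (pt (a * y)) (pt y) V U \<longleftrightarrow> y = r" if "y \<noteq> 0" for y
  proof -
    have U0: "pt 0 = U" by (rule iffD2[OF pt_eq_U refl])
    have "crel b (pt (a * y)) (pt y) V U \<longleftrightarrow> (a * y - v) * y - b * ((a * y) * (y - v)) = 0"
      using crel_pt[of b "a * y" y v 0] by (simp add: v U0)
    also have "(a * y - v) * y - b * ((a * y) * (y - v)) = y * (y * (a * (1 - b)) - v * (1 - a * b))"
      by (simp add: algebra_simps)
    also have "\<dots> = 0 \<longleftrightarrow> y * (a * (1 - b)) = v * (1 - a * b)" using that by simp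
    also have "\<dots> \<longleftrightarrow> y = r" unfolding r_def using e by (subst eq_divide_eq) auto
    finally show ?thesis .
  qed
  have "{(X, Y) \<in> PP \<times> PP. X \<noteq> Y \<and> crel a U U' X Y \<and> crel b X Y V U} = {(pt (a * r), pt r)}" (is "?L = ?R")
  proof
    show "?R \<subseteq> ?L" using e \<open>r \<noteq> 0\<close> by (auto simp: pt crel_base_pt lin)
    show "?L \<subseteq> ?R"
    proof
      fix p assume "p \<in> ?L"
      then obtain X Y where *: "p = (X, Y)" "X \<in> PP" "Y \<in> PP" "X \<noteq> Y"
        "crel a U U' X Y" "crel b X Y V U" by blast
      then obtain y where y: "y \<noteq> 0" "X = pt (a * y)" "Y = pt y" using crel_base_cases e by blast
      with *(6) have "y = r" by (simp add: lin)
      with y * show "p \<in> ?R" by auto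
    qed
  qed
  then show ?thesis by simp
qed

end

section \<open>Triangulations and the count of fillings\<close>

locale noncrossing =
  fixes T :: "(nat \<times> nat) set"
  assumes fin: "finite T"
    and long: "(a, b) \<in> T \<Longrightarrow> a + 2 \<le> b"
    and nc: "D \<in> T \<Longrightarrow> E \<in> T \<Longrightarrow> \<not> crosses D E"
begin

definition inside :: "nat \<Rightarrow> nat \<Rightarrow> (nat \<times> nat) set" where
  "inside u v = {(a, b) \<in> T. u \<le> a \<and> b \<le> v}"

text \<open>The side joining the last vertex of the polygon to the first is not an
  \<open>edge\<close>; it is the root and has its own count.\<close>

definition edge :: "nat \<Rightarrow> nat \<Rightarrow> bool" where
  "edge u v \<longleftrightarrow> v = Suc u \<or> (u, v) \<in> T"

text \<open>The subpolygon on the vertices u, ..., v has v - u + 1 corners, so a triangulation of it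
  has v - u - 2 diagonals, not counting its base \<open>(u, v)\<close>. A single side counts as
  full.\<close>

definition full :: "nat \<Rightarrow> nat \<Rightarrow> bool" where
  "full u v \<longleftrightarrow> u < v \<and> (v = Suc u \<or> card (inside u v - {(u, v)}) + 2 = v - u)"

definition tri :: "nat \<Rightarrow> nat \<Rightarrow> (nat \<times> nat \<times> nat) set" where
  "tri u v = {(a, b, c). u \<le> a \<and> c \<le> v \<and> (a, b) \<in> T \<and> (b, c) \<in> T \<and> (a, c) \<in> T}"

text \<open>The third vertex of the triangle on the base, encoded only by how the chords below the
  base split. That both other sides are edges requires fullness and is derived in
  \<open>full_apex\<close>.\<close>

definition apex :: "nat \<Rightarrow> nat \<Rightarrow> nat \<Rightarrow> bool" where
  "apex u w v \<longleftrightarrow> u < w \<and> w < v \<and> inside u v - {(u, v)} = inside u w \<union> inside w v"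

lemma finite_inside [simp]: "finite (inside u v)"
  by (rule finite_subset[OF _ fin]) (auto simp: inside_def)

lemma inside_Suc [simp]: "inside u (Suc u) = {}"
  using long by (fastforce simp: inside_def)

text \<open>The farthest neighbour \<open>w\<close> of \<open>u\<close> before \<open>v\<close>
  works: a chord passing over \<open>w\<close> either starts at \<open>u\<close>, against
  maximality, or crosses \<open>(u, w)\<close>.\<close>

lemma ex_apex:
  assumes "u + 2 \<le> v"
  shows "\<exists>w. apex u w v"
proof -
  define W where "W = {w. u < w \<and> w < v \<and> edge u w}"
  define w where "w = Max W"
  have W: "finite W" "Suc u \<in> W" using assms by (auto simp: W_def edge_def)
  then have "w \<in> W" unfolding w_def by (intro Max_in) auto
  then have w: "u < w" "w < v" "edge u w" by (auto simp: W_def)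
  have max: "b \<le> w" if "(u, b) \<in> T" "b < v" for b
  proof -
    have "b \<in> W" using that long by (fastforce simp: W_def edge_def)
    then show ?thesis unfolding w_def using W(1) by simp
  qed
  have split: "b \<le> w \<or> w \<le> a" if D: "(a, b) \<in> T" "u \<le> a" "b \<le> v" "(a, b) \<noteq> (u, v)" for a b
  proof (cases "a = u")
    case True
    then show ?thesis using max[of b] D by auto
  next
    case False
    show ?thesis
    proof (rule ccontr)
      assume "\<not> (b \<le> w \<or> w \<le> a)"
      with False D w have "(u, w) \<in> T" "u < a" "a < w" "w < b" by (auto simp: edge_def)
      with nc[OF _ D(1)] show False by (auto simp: crosses_def)
    qed
  qed
  have "inside u v - {(u, v)} = inside u w \<union> inside w v"
  proof
    show "inside u v - {(u, v)} \<subseteq> inside u w \<union> inside w v"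
      using split by (auto simp: inside_def)
    show "inside u w \<union> inside w v \<subseteq> inside u v - {(u, v)}"
      using w by (auto simp: inside_def)
  qed
  with w show ?thesis by (auto simp: apex_def)
qed

lemma card_proper_apex:
  assumes "apex u w v"
  shows "card (inside u v - {(u, v)}) = card (inside u w) + card (inside w v)"
proof -
  have "inside u w \<inter> inside w v = {}" using long by (fastforce simp: inside_def)
  with assms show ?thesis by (simp add: apex_def card_Un_disjoint)
qed

lemma card_inside_le:
  assumes "u < v"
  shows "card (inside u v) \<le> card (inside u v - {(u, v)}) + 1"
  using card_Diff1_le[of "inside u v" "(u, v)"] card_Suc_Diff1[of "inside u v" "(u, v)"]
  by (cases "(u, v) \<in> inside u v") auto

text \<open>Induction along the apex: each half, its own base included, contributes at most its
  length minus 1.\<close>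

lemma card_proper_le:
  assumes "u + 2 \<le> v"
  shows "card (inside u v - {(u, v)}) + 2 \<le> v - u"
  using assms
proof (induction "v - u" arbitrary: u v rule: less_induct)
  case less
  have IH: "card (inside u' v') + 1 \<le> v' - u'" if "u' < v'" "v' - u' < v - u" for u' v'
  proof (cases "v' = Suc u'")
    case False
    then show ?thesis using less(1)[of v' u'] card_inside_le[of u' v'] that by linarith
  qed simp
  obtain w where w: "apex u w v" using ex_apex less by blast
  then have "u < w" "w < v" by (auto simp: apex_def)
  with card_proper_apex[OF w] IH[of u w] IH[of w v] show ?case by linarith
qed

lemma card_inside_bound:
  assumes "u < v"
  shows "card (inside u v) + 1 \<le> v - u"
proof (cases "v = Suc u")
  case False
  then show ?thesis using card_proper_le[of u v] card_inside_le[of u v] assms by linarith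
qed simp

lemma full_if_card_max:
  assumes "u < v" "card (inside u v) + 1 = v - u"
  shows "full u v \<and> edge u v"
proof (cases "v = Suc u")
  case False
  then have le: "card (inside u v - {(u, v)}) + 2 \<le> v - u" using assms by (intro card_proper_le) simp
  have "(u, v) \<in> inside u v"
  proof (rule ccontr)
    assume "(u, v) \<notin> inside u v"
    then show False using le assms by simp
  qed
  moreover have "card (inside u v - {(u, v)}) + 2 = v - u"
    using le assms(2) card_inside_le[OF assms(1)] by linarith
  ultimately show ?thesis using assms(1) by (auto simp: full_def edge_def inside_def)
qed (auto simp: full_def edge_def)

text \<open>Fullness makes the bounds of \<open>card_inside_bound\<close> for the two halves add up
  to an equality, so both are attained, and \<open>full_if_card_max\<close> applies to each
  half.\<close>

lemma full_apex:
  assumes "full u v" "u + 2 \<le> v"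
  obtains w where "apex u w v" "full u w" "full w v" "edge u w" "edge w v"
proof -
  obtain w where w: "apex u w v" using ex_apex assms by blast
  then have "u < w" "w < v" by (auto simp: apex_def)
  moreover have "card (inside u w) + card (inside w v) + 2 = v - u"
    using assms card_proper_apex[OF w] by (auto simp: full_def)
  ultimately have "card (inside u w) + 1 = w - u" "card (inside w v) + 1 = v - w"
    using card_inside_bound[of u w] card_inside_bound[of w v] by linarith+
  with full_if_card_max \<open>u < w\<close> \<open>w < v\<close> w that show ?thesis by blast
qed

lemma finite_tri [simp]: "finite (tri u v)"
proof -
  have "tri u v \<subseteq> (\<lambda>((a, b), (c, d)). (a, b, d)) ` (T \<times> T)"
  proof
    fix t assume "t \<in> tri u v"
    then obtain a b c where "t = (a, b, c)" "(a, b) \<in> T" "(b, c) \<in> T" by (auto simp: tri_def)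
    then show "t \<in> (\<lambda>((a, b), (c, d)). (a, b, d)) ` (T \<times> T)"
      by (intro image_eqI[of _ _ "((a, b), (b, c))"]) auto
  qed
  then show ?thesis using fin finite_subset by blast
qed

lemma tri_Suc [simp]: "tri u (Suc u) = {}"
  using long by (fastforce simp: tri_def)

text \<open>A triangle whose long side is not the base lies on one side of \<open>w\<close>. If its
  long side is the base, the splitting of the chords squeezes its middle vertex to
  \<open>w\<close>.\<close>

lemma tri_apex:
  assumes "apex u w v"
  shows "tri u v = tri u w \<union> tri w v \<union>
    (if (u, w) \<in> T \<and> (w, v) \<in> T \<and> (u, v) \<in> T then {(u, w, v)} else {})" (is "_ = ?R")
proof
  have w: "u < w" "w < v" using assms by (auto simp: apex_def)
  have split: "b \<le> w \<or> w \<le> a" if "(a, b) \<in> T" "u \<le> a" "b \<le> v" "(a, b) \<noteq> (u, v)" for a b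
  proof -
    have "(a, b) \<in> inside u v - {(u, v)}" using that by (auto simp: inside_def)
    then have "(a, b) \<in> inside u w \<union> inside w v" using assms unfolding apex_def by blast
    then show ?thesis by (auto simp: inside_def)
  qed
  show "?R \<subseteq> tri u v" using w by (auto simp: tri_def)
  show "tri u v \<subseteq> ?R"
  proof
    fix t assume "t \<in> tri u v"
    then obtain a b c where t: "t = (a, b, c)" "u \<le> a" "c \<le> v" "(a, b) \<in> T" "(b, c) \<in> T" "(a, c) \<in> T"
      by (auto simp: tri_def)
    have "a < b" "b < c" using t long by fastforce+
    show "t \<in> ?R"
    proof (cases "(a, c) = (u, v)")
      case True
      then have "b \<le> w" "w \<le> b" using split[of a b] split[of b c] t w \<open>a < b\<close> \<open>b < c\<close> by auto
      with t True show ?thesis by auto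
    next
      case False
      with split[of a c] t show ?thesis by (auto simp: tri_def)
    qed
  qed
qed

lemma card_tri_apex:
  assumes "apex u w v"
  shows "card (tri u v) = card (tri u w) + card (tri w v) +
    (if (u, w) \<in> T \<and> (w, v) \<in> T \<and> (u, v) \<in> T then 1 else 0)"
proof -
  have w: "u < w" "w < v" using assms by (auto simp: apex_def)
  have "tri u w \<inter> tri w v = {}" using long by (fastforce simp: tri_def)
  moreover have "(u, w, v) \<notin> tri u w \<union> tri w v" using w by (auto simp: tri_def)
  ultimately show ?thesis by (simp add: tri_apex[OF assms] card_Un_disjoint)
qed

section \<open>Fillings of a subpolygon and their recursion over the apex\<close>

text \<open>Vertex i carries the pair of points x i, x (i + 1) of its two edges.\<close>

definition weak :: "(nat \<times> nat \<Rightarrow> complex) \<Rightarrow> nat \<Rightarrow> nat \<Rightarrow> (nat \<Rightarrow> complex \<times> complex) set" where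
  "weak \<eta> u v = {x \<in> {u..Suc v} \<rightarrow>\<^sub>E PP. (\<forall>i\<in>{u..v}. x i \<noteq> x (Suc i)) \<and>
     (\<forall>a b. (a, b) \<in> inside u v \<longrightarrow> crel (\<eta> (a, b)) (x a) (x (Suc a)) (x b) (x (Suc b)))}"

definition weak_bd :: "(nat \<times> nat \<Rightarrow> complex) \<Rightarrow> nat \<Rightarrow> nat \<Rightarrow> complex \<times> complex \<Rightarrow> complex \<times> complex \<Rightarrow>
    complex \<times> complex \<Rightarrow> complex \<times> complex \<Rightarrow> (nat \<Rightarrow> complex \<times> complex) set" where
  "weak_bd \<eta> u v U U' V V' =
     {x \<in> weak \<eta> u v. x u = U \<and> x (Suc u) = U' \<and> x v = V \<and> x (Suc v) = V'}"

definition econd :: "(nat \<times> nat \<Rightarrow> complex) \<Rightarrow> nat \<Rightarrow> nat \<Rightarrow> complex \<times> complex \<Rightarrow> complex \<times> complex \<Rightarrow>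
    complex \<times> complex \<Rightarrow> complex \<times> complex \<Rightarrow> bool" where
  "econd \<eta> u v U U' V V' \<longleftrightarrow> (if v = Suc u then U' = V else crel (\<eta> (u, v)) U U' V V')"

definition third :: "(nat \<times> nat \<Rightarrow> complex) \<Rightarrow> nat \<Rightarrow> nat \<Rightarrow> nat \<Rightarrow> complex \<times> complex \<Rightarrow> complex \<times> complex \<Rightarrow>
    complex \<times> complex \<Rightarrow> complex \<times> complex \<Rightarrow> ((complex \<times> complex) \<times> (complex \<times> complex)) set" where
  "third \<eta> u w v U U' V V' = {(X, Y) \<in> PP \<times> PP. X \<noteq> Y \<and> econd \<eta> u w U U' X Y \<and> econd \<eta> w v X Y V V'}"

lemma weak_glue:
  assumes w: "apex u w v" and uv: "(u, v) \<in> T \<Longrightarrow> crel (\<eta> (u, v)) U U' V V'"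
    and y: "y \<in> weak_bd \<eta> u w U U' X Y" and z: "z \<in> weak_bd \<eta> w v X Y V V'"
  shows "(\<lambda>i. if i \<le> Suc w then y i else z i) \<in> weak_bd \<eta> u v U U' V V'"
proof -
  define x where "x = (\<lambda>i. if i \<le> Suc w then y i else z i)"
  have uwv: "u < w" "w < v" using w by (auto simp: apex_def)
  have xy: "x i = y i" if "i \<le> Suc w" for i using that by (simp add: x_def)
  \<comment> \<open>The domains overlap in \<open>w\<close> and \<open>Suc w\<close>, where
    \<open>y\<close> and \<open>z\<close> both carry the pair \<open>X\<close>,
    \<open>Y\<close>.\<close>
  have xz: "x i = z i" if "w \<le> i" for i
    using y z that by (cases "i = w \<or> i = Suc w") (auto simp: x_def weak_bd_def)
  have bd: "x u = U" "x (Suc u) = U'" "x v = V" "x (Suc v) = V'"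
    using y z uwv by (auto simp: xy xz weak_bd_def)
  have yE: "y \<in> {u..Suc w} \<rightarrow>\<^sub>E PP" and zE: "z \<in> {w..Suc v} \<rightarrow>\<^sub>E PP"
    using y z by (auto simp: weak_bd_def weak_def)
  have "x \<in> {u..Suc v} \<rightarrow>\<^sub>E PP"
  proof (rule PiE_I)
    fix i assume "i \<in> {u..Suc v}"
    then show "x i \<in> PP"
      using PiE_mem[OF yE, of i] PiE_mem[OF zE, of i] by (cases "i \<le> Suc w") (auto simp: x_def)
  next
    fix i assume "i \<notin> {u..Suc v}"
    then show "x i = undefined"
      using PiE_arb[OF yE, of i] PiE_arb[OF zE, of i] uwv by (cases "i \<le> Suc w") (auto simp: x_def)
  qed
  moreover have "x i \<noteq> x (Suc i)" if "i \<in> {u..v}" for i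
  proof (cases "i \<le> w")
    case True
    then show ?thesis using y that by (auto simp: xy weak_bd_def weak_def)
  next
    case False
    then show ?thesis using z that by (auto simp: xz weak_bd_def weak_def)
  qed
  moreover have "crel (\<eta> (a, b)) (x a) (x (Suc a)) (x b) (x (Suc b))" if "(a, b) \<in> inside u v" for a b
  proof (cases "(a, b) = (u, v)")
    case True
    with that uv bd show ?thesis by (auto simp: inside_def)
  next
    case False
    then have "(a, b) \<in> inside u v - {(u, v)}" using that by simp
    then have "(a, b) \<in> inside u w \<or> (a, b) \<in> inside w v" using w unfolding apex_def by blast
    then show ?thesis
    proof
      assume *: "(a, b) \<in> inside u w"
      then have "b \<le> w" "a + 2 \<le> b" using long by (auto simp: inside_def)
      then show ?thesis using y * by (simp add: xy weak_bd_def weak_def)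
    next
      assume *: "(a, b) \<in> inside w v"
      then have "w \<le> a" "a + 2 \<le> b" using long by (auto simp: inside_def)
      then show ?thesis using z * by (simp add: xz weak_bd_def weak_def)
    qed
  qed
  ultimately show ?thesis using bd by (auto simp: weak_bd_def weak_def x_def[symmetric])
qed

lemma weak_restrict:
  assumes "x \<in> weak \<eta> u v" "u \<le> u'" "v' \<le> v"
  shows "restrict x {u'..Suc v'} \<in> weak \<eta> u' v'"
proof -
  have "crel (\<eta> (a, b)) (restrict x {u'..Suc v'} a) (restrict x {u'..Suc v'} (Suc a))
      (restrict x {u'..Suc v'} b) (restrict x {u'..Suc v'} (Suc b))" if "(a, b) \<in> inside u' v'" for a b
  proof -
    have "u' \<le> a" "a + 2 \<le> b" "b \<le> v'" "(a, b) \<in> inside u v" using that long assms by (auto simp: inside_def)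
    then show ?thesis using assms(1) by (auto simp: weak_def)
  qed
  moreover have "x i \<in> PP" if "i \<in> {u'..Suc v'}" for i
  proof -
    have "x \<in> {u..Suc v} \<rightarrow>\<^sub>E PP" using assms(1) by (simp add: weak_def)
    from PiE_mem[OF this, of i] show ?thesis using assms(2,3) that by simp
  qed
  ultimately show ?thesis using assms by (auto simp: weak_def)
qed

text \<open>Once the pair at \<open>w\<close> is fixed, the two halves are independent, since no
  chord other than the base passes over \<open>w\<close>. The two edges at \<open>w\<close> are what
  forces that pair into \<open>third\<close>.\<close>

lemma bij_betw_weak_apex:
  assumes w: "apex u w v" "edge u w" "edge w v" and uv: "(u, v) \<in> T \<Longrightarrow> crel (\<eta> (u, v)) U U' V V'"
  shows "bij_betw (\<lambda>x. ((x w, x (Suc w)), restrict x {u..Suc w}, restrict x {w..Suc v}))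
    (weak_bd \<eta> u v U U' V V')
    (Sigma (third \<eta> u w v U U' V V') (\<lambda>(X, Y). weak_bd \<eta> u w U U' X Y \<times> weak_bd \<eta> w v X Y V V'))"
proof (rule bij_betw_byWitness[where f' = "\<lambda>(_, y, z) i. if i \<le> Suc w then y i else z i"])
  have uwv: "u < w" "w < v" using w by (auto simp: apex_def)
  let ?f = "\<lambda>x. ((x w, x (Suc w)), restrict x {u..Suc w}, restrict x {w..Suc v})"
  let ?g = "\<lambda>(_, y, z) i. if i \<le> Suc w then y i else z i"
  let ?A = "weak_bd \<eta> u v U U' V V'"
  let ?B = "Sigma (third \<eta> u w v U U' V V') (\<lambda>(X, Y). weak_bd \<eta> u w U U' X Y \<times> weak_bd \<eta> w v X Y V V')"
  show "\<forall>x\<in>?A. ?g (?f x) = x"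
  proof
    fix x assume "x \<in> ?A"
    then have "x \<in> {u..Suc v} \<rightarrow>\<^sub>E PP" by (simp add: weak_bd_def weak_def)
    then have "x i = undefined" if "i \<notin> {u..Suc v}" for i using that by (rule PiE_arb)
    then show "?g (?f x) = x" using uwv by (simp add: fun_eq_iff)
  qed
  show "\<forall>p\<in>?B. ?f (?g p) = p"
  proof
    fix p assume "p \<in> ?B"
    then obtain X Y y z where p: "p = ((X, Y), y, z)"
      and y: "y \<in> weak_bd \<eta> u w U U' X Y" and z: "z \<in> weak_bd \<eta> w v X Y V V'" by auto
    have yE: "y \<in> extensional {u..Suc w}" and zE: "z \<in> extensional {w..Suc v}"
      using y z by (auto simp: weak_bd_def weak_def PiE_def)
    have xz: "(if i \<le> Suc w then y i else z i) = z i" if "w \<le> i" for i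
      using y z that by (cases "i = w \<or> i = Suc w") (auto simp: weak_bd_def)
    have "restrict (?g p) {u..Suc w} = y"
      by (rule extensionalityI[OF restrict_extensional yE]) (simp add: p)
    moreover have "restrict (?g p) {w..Suc v} = z"
      by (rule extensionalityI[OF restrict_extensional zE]) (simp add: p xz)
    moreover have "?g p w = X" "?g p (Suc w) = Y" using y by (auto simp: p weak_bd_def)
    ultimately show "?f (?g p) = p" by (simp add: p)
  qed
  show "?f ` ?A \<subseteq> ?B"
  proof
    fix p assume "p \<in> ?f ` ?A"
    then obtain x where x: "x \<in> ?A" "p = ?f x" by blast
    then have xw: "x \<in> weak \<eta> u v" and bd: "x u = U" "x (Suc u) = U'" "x v = V" "x (Suc v) = V'"
      by (auto simp: weak_bd_def)
    have xE: "x \<in> {u..Suc v} \<rightarrow>\<^sub>E PP" using xw by (simp add: weak_def)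
    have "x w \<in> PP" "x (Suc w) \<in> PP" using uwv by (simp_all add: PiE_mem[OF xE])
    moreover have "x w \<noteq> x (Suc w)" using xw uwv by (simp add: weak_def)
    moreover have "econd \<eta> u w U U' (x w) (x (Suc w))"
    proof (cases "w = Suc u")
      case False
      then have "(u, w) \<in> inside u v" using w(2) uwv by (auto simp: edge_def inside_def)
      then show ?thesis using xw bd False by (auto simp: econd_def weak_def)
    qed (use bd in \<open>simp add: econd_def\<close>)
    moreover have "econd \<eta> w v (x w) (x (Suc w)) V V'"
    proof (cases "v = Suc w")
      case False
      then have "(w, v) \<in> inside u v" using w(3) uwv by (auto simp: edge_def inside_def)
      then show ?thesis using xw bd False by (auto simp: econd_def weak_def)
    qed (use bd in \<open>simp add: econd_def\<close>)
    moreover have "restrict x {u..Suc w} \<in> weak_bd \<eta> u w U U' (x w) (x (Suc w))"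
      using weak_restrict[OF xw, of u w] uwv bd by (auto simp: weak_bd_def)
    moreover have "restrict x {w..Suc v} \<in> weak_bd \<eta> w v (x w) (x (Suc w)) V V'"
      using weak_restrict[OF xw, of w v] uwv bd by (auto simp: weak_bd_def)
    ultimately show "p \<in> ?B" by (auto simp: x(2) third_def)
  qed
  show "?g ` ?B \<subseteq> ?A"
    using weak_glue[where \<eta> = \<eta>, OF w(1) uv] by auto
qed

text \<open>The counts for the halves are the same for every admissible pair at \<open>w\<close>, so
  the sum over \<open>third\<close> is a product. Finiteness follows from the cardinalities being
  nonzero.\<close>

lemma card_weak_apex:
  assumes "apex u w v" "edge u w" "edge w v" "(u, v) \<in> T \<Longrightarrow> crel (\<eta> (u, v)) U U' V V'"
    and M: "card (third \<eta> u w v U U' V V') = 2 ^ m"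
    and l: "\<And>X Y. X \<in> PP \<Longrightarrow> Y \<in> PP \<Longrightarrow> X \<noteq> Y \<Longrightarrow> econd \<eta> u w U U' X Y \<Longrightarrow> card (weak_bd \<eta> u w U U' X Y) = 2 ^ k"
    and r: "\<And>X Y. X \<in> PP \<Longrightarrow> Y \<in> PP \<Longrightarrow> X \<noteq> Y \<Longrightarrow> econd \<eta> w v X Y V V' \<Longrightarrow> card (weak_bd \<eta> w v X Y V V') = 2 ^ l"
  shows "card (weak_bd \<eta> u v U U' V V') = 2 ^ (k + l + m)"
proof -
  let ?M = "third \<eta> u w v U U' V V'"
  let ?F = "\<lambda>(X, Y). weak_bd \<eta> u w U U' X Y \<times> weak_bd \<eta> w v X Y V V'"
  have F: "card (?F p) = 2 ^ (k + l)" if "p \<in> ?M" for p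
  proof -
    obtain X Y where p: "p = (X, Y)" by (cases p)
    with that have XY: "X \<in> PP" "Y \<in> PP" "X \<noteq> Y" "econd \<eta> u w U U' X Y" "econd \<eta> w v X Y V V'"
      by (simp_all add: third_def)
    show ?thesis
      using l[OF XY(1-4)] r[OF XY(1-3,5)] by (simp add: p card_cartesian_product power_add)
  qed
  have "finite (?F p)" if "p \<in> ?M" for p
    using F[OF that] by (intro card_ge_0_finite) simp
  moreover have "finite ?M" using M by (intro card_ge_0_finite) simp
  ultimately have "card (Sigma ?M ?F) = (\<Sum>p\<in>?M. card (?F p))" by (intro card_SigmaI) auto
  also have "\<dots> = 2 ^ (k + l + m)" using F M by (simp add: power_add mult.commute)
  finally show ?thesis using bij_betw_same_card[OF bij_betw_weak_apex[where \<eta> = \<eta>, OF assms(1-4)]] by simp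
qed

text \<open>The hypotheses allow \<open>V' = U\<close>, which is the situation at the root, so the
  lemma serves both counts below.\<close>

lemma card_third_side:
  assumes uwv: "apex u w v" and side: "w = Suc u \<or> v = Suc w"
    and P: "U \<in> PP" "U' \<in> PP" "V \<in> PP" "V' \<in> PP"
    and ne: "U \<noteq> U'" "V \<noteq> V'" "U \<noteq> V" "U' \<noteq> V" "U' \<noteq> V'"
    and \<eta>: "w \<noteq> Suc u \<Longrightarrow> \<eta> (u, w) \<noteq> 1" "v \<noteq> Suc w \<Longrightarrow> \<eta> (w, v) \<noteq> 1"
  shows "card (third \<eta> u w v U U' V V') = 1"
proof (cases "w = Suc u"; cases "v = Suc w")
  assume "w = Suc u" "v = Suc w"
  then show ?thesis using card_third_vertex_both[of U' V] P ne by (simp add: third_def econd_def)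
next
  assume "w = Suc u" "v \<noteq> Suc w"
  then show ?thesis using card_third_vertex_left[of U' V V' "\<eta> (w, v)"] P ne \<eta>
    by (simp add: third_def econd_def)
next
  assume "w \<noteq> Suc u" "v = Suc w"
  then show ?thesis using card_third_vertex_right[of U U' V "\<eta> (u, w)"] P ne \<eta>
    by (simp add: third_def econd_def)
next
  assume "w \<noteq> Suc u" "v \<noteq> Suc w"
  with side show ?thesis by simp
qed

context
  fixes \<eta> :: "nat \<times> nat \<Rightarrow> complex"
  assumes \<eta>: "\<And>D. D \<in> T \<Longrightarrow> \<eta> D \<noteq> 0 \<and> \<eta> D \<noteq> 1"
    and disc: "\<And>a b c. (a, b) \<in> T \<Longrightarrow> (b, c) \<in> T \<Longrightarrow> (a, c) \<in> T \<Longrightarrow>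
      tri_disc (\<eta> (a, b)) (\<eta> (b, c)) (\<eta> (a, c)) \<noteq> 0"
begin

text \<open>The statement covers all boundary pairs compatible along the base, because the pair at
  the apex varies over \<open>third\<close>. Compatibility along a diagonal makes the four known
  points distinct by \<open>crel_distinct\<close>, as the triangle step requires.\<close>

lemma card_weak_bd:
  assumes "full u v" "edge u v" "U \<in> PP" "U' \<in> PP" "V \<in> PP" "V' \<in> PP" "U \<noteq> U'" "V \<noteq> V'"
    and "econd \<eta> u v U U' V V'"
  shows "card (weak_bd \<eta> u v U U' V V') = 2 ^ card (tri u v)"
  using assms
proof (induction "v - u" arbitrary: u v U U' V V' rule: less_induct)
  case less
  have uv: "u < v" using less.prems by (simp add: full_def)
  show ?case
  proof (cases "v = Suc u")
    case True
    \<comment> \<open>A single side involves only three points, the middle one being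
      \<open>U' = V\<close>, so the filling is determined.\<close>
    define x where "x = (\<lambda>i. if i = u then U else if i = Suc u then U' else if i = Suc (Suc u) then V' else undefined)"
    have x: "x u = U" "x (Suc u) = U'" "x (Suc (Suc u)) = V'" "\<And>i. i \<notin> {u..Suc (Suc u)} \<Longrightarrow> x i = undefined"
      by (auto simp: x_def)
    have iv: "i = u \<or> i = Suc u \<or> i = Suc (Suc u)" if "i \<in> {u..Suc (Suc u)}" for i using that by auto
    have "U' = V" using less.prems True by (simp add: econd_def)
    have "z = x" if "z \<in> weak_bd \<eta> u v U U' V V'" for z
    proof -
      have z: "z \<in> extensional {u..Suc (Suc u)}" "z u = U" "z (Suc u) = U'" "z (Suc (Suc u)) = V'"
        using that True by (auto simp: weak_bd_def weak_def PiE_def)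
      have "x \<in> extensional {u..Suc (Suc u)}" using x(4) by (simp add: extensional_def)
      then show ?thesis
      proof (rule extensionalityI[OF z(1)])
        fix i assume "i \<in> {u..Suc (Suc u)}"
        from iv[OF this] show "z i = x i" using z x by metis
      qed
    qed
    moreover have "x \<in> weak_bd \<eta> u v U U' V V'"
    proof -
      have "x \<in> {u..Suc (Suc u)} \<rightarrow>\<^sub>E PP"
        using x iv less.prems by (intro PiE_I) metis+
      moreover have "x i \<noteq> x (Suc i)" if "i \<in> {u..Suc u}" for i
      proof -
        have "i = u \<or> i = Suc u" using that by auto
        then show ?thesis using x less.prems \<open>U' = V\<close> by metis
      qed
      ultimately show ?thesis using x \<open>U' = V\<close> by (simp add: True weak_bd_def weak_def)
    qed
    ultimately have "weak_bd \<eta> u v U U' V V' = {x}" by blast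
    then show ?thesis by (simp add: True)
  next
    case False
    then have uv2: "u + 2 \<le> v" and T: "(u, v) \<in> T" using uv less.prems(2) by (auto simp: edge_def)
    have g: "crel (\<eta> (u, v)) U U' V V'" using less.prems(9) False by (simp add: econd_def)
    have ne: "U \<noteq> V" "U \<noteq> V'" "U' \<noteq> V" "U' \<noteq> V'"
      using crel_distinct[OF g] \<eta>[OF T] less.prems by auto
    obtain w where w: "apex u w v" "full u w" "full w v" "edge u w" "edge w v"
      using full_apex[OF less.prems(1) uv2] .
    then have uwv: "u < w" "w < v" by (auto simp: apex_def)
    let ?m = "if (u, w) \<in> T \<and> (w, v) \<in> T \<and> (u, v) \<in> T then 1 else 0"
    have "card (third \<eta> u w v U U' V V') = 2 ^ ?m"
    proof (cases "w = Suc u \<or> v = Suc w")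
      case True
      then have "\<not> ((u, w) \<in> T \<and> (w, v) \<in> T)" using long by fastforce
      moreover have "card (third \<eta> u w v U U' V V') = 1"
        using card_third_side[OF w(1) True less.prems(3-8) ne(1,3,4)] w \<eta> by (auto simp: edge_def)
      ultimately show ?thesis by auto
    next
      case False
      then have TT: "(u, w) \<in> T" "(w, v) \<in> T" using w by (auto simp: edge_def)
      then have "card (third \<eta> u w v U U' V V') = 2"
        using card_third_vertex_interior[OF less.prems(3,4,7) less.prems(5,6,8) g,
            of "\<eta> (u, w)" "\<eta> (w, v)"] False \<eta> T disc[of u w v]
        by (simp add: third_def econd_def)
      then show ?thesis using TT T by simp
    qed
    moreover have "card (weak_bd \<eta> u w U U' X Y) = 2 ^ card (tri u w)"
      if "X \<in> PP" "Y \<in> PP" "X \<noteq> Y" "econd \<eta> u w U U' X Y" for X Y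
      by (rule less.hyps) (use uwv w less.prems that in simp_all)
    moreover have "card (weak_bd \<eta> w v X Y V V') = 2 ^ card (tri w v)"
      if "X \<in> PP" "Y \<in> PP" "X \<noteq> Y" "econd \<eta> w v X Y V V'" for X Y
      by (rule less.hyps) (use uwv w less.prems that in simp_all)
    ultimately have "card (weak_bd \<eta> u v U U' V V') = 2 ^ (card (tri u w) + card (tri w v) + ?m)"
      by (rule card_weak_apex[where \<eta> = \<eta>, OF w(1,4,5) g])
    then show ?thesis using card_tri_apex[OF w(1)] by simp
  qed
qed

text \<open>The root triangle offers a single choice even when both its other sides are diagonals,
  in agreement with \<open>tri\<close>, which does not count it because its base is not in
  \<open>T\<close>.\<close>

lemma card_weak_bd_root:
  assumes "full u v" "u + 2 \<le> v" "(u, v) \<notin> T"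
    and P: "U \<in> PP" "U' \<in> PP" "V \<in> PP" "U \<noteq> U'" "U \<noteq> V" "U' \<noteq> V"
    and prod: "\<And>w. (u, w) \<in> T \<Longrightarrow> (w, v) \<in> T \<Longrightarrow> \<eta> (u, w) * \<eta> (w, v) \<noteq> 1"
  shows "card (weak_bd \<eta> u v U U' V U) = 2 ^ card (tri u v)"
proof -
  obtain w where w: "apex u w v" "full u w" "full w v" "edge u w" "edge w v"
    using full_apex[OF assms(1,2)] .
  have "card (third \<eta> u w v U U' V U) = 2 ^ 0"
  proof (cases "w = Suc u \<or> v = Suc w")
    case True
    then show ?thesis
      using card_third_side[OF w(1) True P(1-3) P(1,4), of \<eta>] P w \<eta> by (auto simp: edge_def)
  next
    case False
    then have TT: "(u, w) \<in> T" "(w, v) \<in> T" using w by (auto simp: edge_def)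
    then show ?thesis
      using card_third_vertex_root[OF P(1,2,4) P(3), of "\<eta> (u, w)" "\<eta> (w, v)"] False \<eta> prod P
      by (simp add: third_def econd_def)
  qed
  moreover have "card (weak_bd \<eta> u w U U' X Y) = 2 ^ card (tri u w)"
    if "X \<in> PP" "Y \<in> PP" "X \<noteq> Y" "econd \<eta> u w U U' X Y" for X Y
    by (rule card_weak_bd) (use w P that in simp_all)
  moreover have "card (weak_bd \<eta> w v X Y V U) = 2 ^ card (tri w v)"
    if "X \<in> PP" "Y \<in> PP" "X \<noteq> Y" "econd \<eta> w v X Y V U" for X Y
    by (rule card_weak_bd) (use w P that in simp_all)
  ultimately have "card (weak_bd \<eta> u v U U' V U) = 2 ^ (card (tri u w) + card (tri w v) + 0)"
    using assms(3) by (intro card_weak_apex[where \<eta> = \<eta>, OF w(1,4,5)]) blast+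
  then show ?thesis using card_tri_apex[OF w(1)] assms(3) by simp
qed

end

end

section \<open>Normal form of configurations\<close>

text \<open>Normal form of a configuration: the first point goes to infinity, the second to 0, the
last to 1.  Index n + 1 repeats the first point.\<close>

definition coord :: "nat \<Rightarrow> (nat \<Rightarrow> complex) \<Rightarrow> nat \<Rightarrow> complex" where
  "coord n x a = ((x a - x 2) * (x n - x 1)) / ((x a - x 1) * (x n - x 2))"

definition normal_form :: "nat \<Rightarrow> (nat \<Rightarrow> complex) \<Rightarrow> nat \<Rightarrow> complex \<times> complex" where
  "normal_form n x = restrict (\<lambda>a. if a = 1 \<or> a = Suc n then (1, 0) else (coord n x a, 1)) {1..Suc n}"

definition cr_eq :: "nat set \<Rightarrow> complex \<Rightarrow> (nat \<Rightarrow> complex \<times> complex) \<Rightarrow> bool" where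
  "cr_eq S y X = (let l = sorted_list_of_set S in
     br (X (l!0)) (X (l!2)) * br (X (l!1)) (X (l!3)) = y * (br (X (l!0)) (X (l!3)) * br (X (l!1)) (X (l!2))))"

definition normal_configs :: "nat \<Rightarrow> (nat \<Rightarrow> complex \<times> complex) set" where
  "normal_configs n = {X \<in> {1..Suc n} \<rightarrow>\<^sub>E PP. inj_on X {1..n} \<and>
     X 1 = (1, 0) \<and> X 2 = (0, 1) \<and> X n = (1, 1) \<and> X (Suc n) = (1, 0)}"

lemma config_ne: "x \<in> config A \<Longrightarrow> a \<in> A \<Longrightarrow> b \<in> A \<Longrightarrow> a \<noteq> b \<Longrightarrow> x a \<noteq> x b"
  by (auto simp: config_def inj_on_def)

lemma sorted_list_of_set_4:
  fixes p q r s :: nat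
  assumes "p < q" "q < r" "r < s"
  shows "sorted_list_of_set {p, q, r, s} = [p, q, r, s]"
  using sorted_list_of_set.idem_if_sorted_distinct[of "[p, q, r, s]"] assms by simp

lemma card_4_sorted:
  fixes S :: "nat set"
  assumes "card S = 4"
  obtains p q r s where "S = {p, q, r, s}" "p < q" "q < r" "r < s"
proof -
  define l where "l = sorted_list_of_set S"
  have fin: "finite S" using assms by (intro card_ge_0_finite) simp
  then have l: "length l = 4" "set l = S" "sorted_wrt (<) l" using assms by (auto simp: l_def)
  then obtain p q r s where "l = [p, q, r, s]"
    by (auto simp: numeral_eq_Suc length_Suc_conv)
  with l that show ?thesis by auto
qed

context
  fixes n :: nat
  assumes n: "n \<ge> 3"
begin

text \<open>A Moebius map multiplies the difference of two points by one factor per point and a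
  constant. These factors cancel from any cross-ratio, which is how
  \<open>cross_ratio_eq_iff\<close> uses this.\<close>

lemma br_normal_form:
  assumes x: "x \<in> config {1..n}"
  obtains K \<mu> where "K \<noteq> 0" "\<And>a. a \<in> {1..n} \<Longrightarrow> \<mu> a \<noteq> 0"
    "\<And>a b. a \<in> {1..n} \<Longrightarrow> b \<in> {1..n} \<Longrightarrow>
      br (normal_form n x a) (normal_form n x b) = K * \<mu> a * \<mu> b * (x a - x b)"
proof -
  have ne: "x a \<noteq> x b" if "a \<in> {1..n}" "b \<in> {1..n}" "a \<noteq> b" for a b
    using config_ne[OF x] that by blast
  have ne3: "x n - x 2 \<noteq> 0" "x n - x 1 \<noteq> 0" "x 2 - x 1 \<noteq> 0"
    using ne[of n 2] ne[of n 1] ne[of 2 1] n by auto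
  \<comment> \<open>Chosen so that \<open>c * coord n x a\<close> is \<open>1 / (x a - x 1)\<close>
    up to an additive constant; differences of coordinates are then differences of
    reciprocals.\<close>
  define c where "c = - (x n - x 2) / ((x n - x 1) * (x 2 - x 1))"
  have c: "c \<noteq> 0" using ne3 by (simp add: c_def)
  have co: "c * coord n x a = 1 / (x a - x 1) - 1 / (x 2 - x 1)" if "a \<in> {1..n}" "a \<noteq> 1" for a
  proof -
    have "x a - x 1 \<noteq> 0" using ne[of a 1] that n by auto
    then have "c * coord n x a = (x 2 - x a) / ((x a - x 1) * (x 2 - x 1))"
      using ne3 by (simp add: c_def coord_def divide_simps) (simp add: algebra_simps)
    also have "\<dots> = 1 / (x a - x 1) - 1 / (x 2 - x 1)"
      using \<open>x a - x 1 \<noteq> 0\<close> ne3 by (simp add: divide_simps)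
    finally show ?thesis .
  qed
  \<comment> \<open>The value at 1 compensates for the representative \<open>(1, 0)\<close> of
    infinity, whose bracket with any finite point is 1.\<close>
  define \<mu> where "\<mu> a = (if a = 1 then c else 1 / (x a - x 1))" for a
  show ?thesis
  proof (rule that[of "- 1 / c" \<mu>])
    show "\<mu> a \<noteq> 0" if "a \<in> {1..n}" for a using c ne[of a 1] that n by (auto simp: \<mu>_def)
    fix a b assume ab: "a \<in> {1..n}" "b \<in> {1..n}"
    then have N: "normal_form n x a = (if a = 1 then (1, 0) else (coord n x a, 1))"
      "normal_form n x b = (if b = 1 then (1, 0) else (coord n x b, 1))"
      by (auto simp: normal_form_def)
    have "c * br (normal_form n x a) (normal_form n x b) = - \<mu> a * \<mu> b * (x a - x b)"
    proof (cases "a = 1"; cases "b = 1")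
      assume "a = 1" "b = 1" then show ?thesis by simp
    next
      assume *: "a = 1" "b \<noteq> 1"
      then have "x b - x 1 \<noteq> 0" using ne[of b 1] ab n by auto
      with * show ?thesis unfolding N by (simp add: br_def \<mu>_def divide_simps) (simp add: algebra_simps)
    next
      assume *: "a \<noteq> 1" "b = 1"
      then have "x a - x 1 \<noteq> 0" using ne[of a 1] ab n by auto
      with * show ?thesis unfolding N by (simp add: br_def \<mu>_def divide_simps)
    next
      assume *: "a \<noteq> 1" "b \<noteq> 1"
      then have "x a - x 1 \<noteq> 0" "x b - x 1 \<noteq> 0" using ne[of b 1] ne[of a 1] ab n by auto
      moreover have "c * br (normal_form n x a) (normal_form n x b) = 1 / (x a - x 1) - 1 / (x b - x 1)"
        unfolding N using * co[of a] co[of b] ab by (simp add: br_def right_diff_distrib)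
      ultimately show ?thesis using * by (simp add: \<mu>_def divide_simps)
    qed
    then have "br (normal_form n x a) (normal_form n x b) = - \<mu> a * \<mu> b * (x a - x b) / c"
      using c by (metis nonzero_mult_div_cancel_left)
    then show "br (normal_form n x a) (normal_form n x b) = - 1 / c * \<mu> a * \<mu> b * (x a - x b)"
      by simp
  qed (use c in simp)
qed

lemma cross_ratio_eq_iff:
  assumes x: "x \<in> config {1..n}" and S: "S \<subseteq> {1..n}" "card S = 4"
  shows "cross_ratio S x = y \<longleftrightarrow> cr_eq S y (normal_form n x)"
proof -
  obtain p q r s where pqrs: "S = {p, q, r, s}" "p < q" "q < r" "r < s"
    using card_4_sorted[OF S(2)] .
  have l: "sorted_list_of_set S = [p, q, r, s]" unfolding pqrs(1) by (rule sorted_list_of_set_4) fact+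
  have mem: "p \<in> {1..n}" "q \<in> {1..n}" "r \<in> {1..n}" "s \<in> {1..n}" using S(1) pqrs(1) by blast+
  obtain K \<mu> where K: "K \<noteq> 0" and \<mu>: "\<And>a. a \<in> {1..n} \<Longrightarrow> \<mu> a \<noteq> 0"
    and br: "\<And>a b. a \<in> {1..n} \<Longrightarrow> b \<in> {1..n} \<Longrightarrow>
      br (normal_form n x a) (normal_form n x b) = K * \<mu> a * \<mu> b * (x a - x b)"
    using br_normal_form[OF x] by blast
  define L where "L = K * K * \<mu> p * \<mu> q * \<mu> r * \<mu> s"
  have L: "L \<noteq> 0" using K \<mu> mem by (simp add: L_def)
  have "x p \<noteq> x s" "x q \<noteq> x r" using config_ne[OF x] mem pqrs by auto
  then have "cross_ratio S x = y \<longleftrightarrow> (x p - x r) * (x q - x s) = y * ((x p - x s) * (x q - x r))"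
    by (simp add: cross_ratio_def l divide_eq_eq)
  also have "\<dots> \<longleftrightarrow> L * ((x p - x r) * (x q - x s)) = L * (y * ((x p - x s) * (x q - x r)))"
    using L by simp
  also have "\<dots> \<longleftrightarrow> cr_eq S y (normal_form n x)"
  proof -
    have "L * ((x p - x r) * (x q - x s)) = br (normal_form n x p) (normal_form n x r) * br (normal_form n x q) (normal_form n x s)"
      unfolding br[OF mem(1,3)] br[OF mem(2,4)] L_def by (simp only: mult_ac)
    moreover have "L * (y * ((x p - x s) * (x q - x r))) =
        y * (br (normal_form n x p) (normal_form n x s) * br (normal_form n x q) (normal_form n x r))"
      unfolding br[OF mem(1,4)] br[OF mem(2,3)] L_def by (simp only: mult_ac)
    moreover have "cr_eq S y (normal_form n x) \<longleftrightarrow>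
        br (normal_form n x p) (normal_form n x r) * br (normal_form n x q) (normal_form n x s) =
        y * (br (normal_form n x p) (normal_form n x s) * br (normal_form n x q) (normal_form n x r))"
      by (simp add: cr_eq_def l)
    ultimately show ?thesis by (simp only:)
  qed
  finally show ?thesis .
qed

lemma normal_form_in_normal_configs:
  assumes x: "x \<in> config {1..n}"
  shows "normal_form n x \<in> normal_configs n"
proof -
  obtain K \<mu> where K: "K \<noteq> 0" and \<mu>: "\<And>a. a \<in> {1..n} \<Longrightarrow> \<mu> a \<noteq> 0"
    and br: "\<And>a b. a \<in> {1..n} \<Longrightarrow> b \<in> {1..n} \<Longrightarrow>
      br (normal_form n x a) (normal_form n x b) = K * \<mu> a * \<mu> b * (x a - x b)"
    using br_normal_form[OF x] by blast
  have "inj_on (normal_form n x) {1..n}"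
  proof (rule inj_onI)
    fix a b assume ab: "a \<in> {1..n}" "b \<in> {1..n}" and eq: "normal_form n x a = normal_form n x b"
    have "K * \<mu> a * \<mu> b * (x a - x b) = 0" using br[OF ab] by (simp add: eq)
    then have "x a = x b" using K \<mu> ab by simp
    then show "a = b" using config_ne[OF x] ab by blast
  qed
  moreover have "normal_form n x \<in> {1..Suc n} \<rightarrow>\<^sub>E PP"
    unfolding normal_form_def by (intro restrict_PiE_iff[THEN iffD2]) (auto simp: PP_def)
  moreover have "normal_form n x 1 = (1, 0)" "normal_form n x (Suc n) = (1, 0)"
    using n by (auto simp: normal_form_def)
  moreover have "normal_form n x 2 = (0, 1)"
    using n by (auto simp: normal_form_def coord_def)
  moreover have "normal_form n x n = (1, 1)"
    using n config_ne[OF x, of n 1] config_ne[OF x, of n 2] by (auto simp: normal_form_def coord_def)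
  ultimately show ?thesis by (simp add: normal_configs_def)
qed

text \<open>A normal form has a point at infinity whereas \<open>config\<close> has only finite
  points. The map z to 1 / (z + s) brings infinity to 0, with \<open>s\<close> chosen so that no
  other point is sent to infinity.\<close>

lemma normal_form_surj:
  assumes X: "X \<in> normal_configs n"
  obtains x where "x \<in> config {1..n}" "normal_form n x = X"
proof -
  have XE: "X \<in> {1..Suc n} \<rightarrow>\<^sub>E PP" and inj: "inj_on X {1..n}"
    and X1: "X 1 = (1, 0)" and X2: "X 2 = (0, 1)" and Xn: "X n = (1, 1)" and XS: "X (Suc n) = (1, 0)"
    using X by (auto simp: normal_configs_def)
  define z where "z a = fst (X a)" for a
  have z: "X a = (z a, 1)" if "a \<in> {2..n}" for a
  proof -
    have "X a \<in> PP" using PiE_mem[OF XE, of a] that by simp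
    moreover have "X a \<noteq> (1, 0)"
    proof
      assume "X a = (1, 0)"
      then have "X a = X 1" by (simp only: X1)
      then have "a = 1" using inj_onD[OF inj, of a 1] that n by simp
      with that show False by simp
    qed
    ultimately show ?thesis by (auto simp: PP_def z_def)
  qed
  have z2: "z 2 = 0" and zn: "z n = 1" by (simp_all add: z_def X2 Xn)
  have zne: "z a \<noteq> z b" if "a \<in> {2..n}" "b \<in> {2..n}" "a \<noteq> b" for a b
  proof
    assume "z a = z b"
    then have "X a = X b" using z that by simp
    then show False using inj_onD[OF inj, of a b] that by simp
  qed
  have "finite ((\<lambda>a. - z a) ` {2..n})" by simp
  then obtain s where s: "s \<notin> (\<lambda>a. - z a) ` {2..n}"
    using ex_new_if_finite[OF infinite_UNIV_char_0] by blast
  have s: "z a + s \<noteq> 0" if "a \<in> {2..n}" for a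
  proof
    assume "z a + s = 0"
    then have "s = - z a" by (simp add: add_eq_0_iff)
    with s that show False by blast
  qed
  define x where "x a = (if a \<in> {2..n} then 1 / (z a + s) else 0)" for a
  have "inj_on x {1..n}"
  proof (rule inj_onI)
    fix a b assume ab: "a \<in> {1..n}" "b \<in> {1..n}" and eq: "x a = x b"
    show "a = b"
    proof (cases "a = 1"; cases "b = 1")
      assume "a \<noteq> 1" "b \<noteq> 1"
      then have m: "a \<in> {2..n}" "b \<in> {2..n}" using ab by auto
      then have "z a = z b" using eq s[of a] s[of b] by (simp add: x_def)
      then show ?thesis using zne m by blast
    next
      assume *: "a = 1" "b \<noteq> 1"
      then have "b \<in> {2..n}" using ab by auto
      with eq * s[of b] show ?thesis by (simp add: x_def)
    next
      assume *: "a \<noteq> 1" "b = 1"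
      then have "a \<in> {2..n}" using ab by auto
      with eq * s[of a] show ?thesis by (simp add: x_def)
    qed simp
  qed
  then have "x \<in> config {1..n}" by (auto simp: config_def x_def)
  moreover have "normal_form n x = X"
  proof (rule extensionalityI)
    show "normal_form n x \<in> extensional {1..Suc n}" by (simp add: normal_form_def)
    show "X \<in> extensional {1..Suc n}" using XE by (simp add: PiE_def)
    fix a assume a: "a \<in> {1..Suc n}"
    show "normal_form n x a = X a"
    proof (cases "a = 1 \<or> a = Suc n")
      case True
      then show ?thesis using X1 XS n by (auto simp: normal_form_def)
    next
      case False
      then have m: "a \<in> {2..n}" using a by auto
      have nz: "z a + s \<noteq> 0" "s \<noteq> 0" "1 + s \<noteq> 0"
        using s[OF m] s[of 2] s[of n] n by (auto simp: z2 zn)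
      have xs: "x a = 1 / (z a + s)" "x 2 = 1 / s" "x n = 1 / (1 + s)" "x 1 = 0"
        using m n by (simp_all add: x_def z2 zn)
      have "1 / (z a + s) - 1 / s = - z a / ((z a + s) * s)" "1 / (1 + s) - 1 / s = - 1 / ((1 + s) * s)"
        using nz by (simp_all add: divide_simps)
      then have "coord n x a = z a"
        unfolding coord_def xs using nz by simp
      then show ?thesis using m False by (simp add: normal_form_def z)
    qed
  qed
  ultimately show ?thesis by (rule that)
qed

lemma coord_mobius:
  assumes "(x, y) \<in> mobius_rel {1..n}" "a \<in> {2..n}"
  shows "coord n x a = coord n y a"
proof -
  obtain p q r s where det: "p * s - q * r \<noteq> 0"
    and y: "\<And>i. i \<in> {1..n} \<Longrightarrow> r * x i + s \<noteq> 0 \<and> y i = (p * x i + q) / (r * x i + s)"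
    and x: "x \<in> config {1..n}"
    using assms(1) unfolding mobius_rel_def by blast
  define m where "m i = 1 / (r * x i + s)" for i
  have m: "m i \<noteq> 0" if "i \<in> {1..n}" for i using y[OF that] by (simp add: m_def)
  have d: "y i - y j = (p * s - q * r) * m i * m j * (x i - x j)" if "i \<in> {1..n}" "j \<in> {1..n}" for i j
  proof -
    have nz: "r * x i + s \<noteq> 0" "r * x j + s \<noteq> 0"
      and yij: "y i = (p * x i + q) / (r * x i + s)" "y j = (p * x j + q) / (r * x j + s)"
      using y that by blast+
    have "y i - y j = ((p * x i + q) * (r * x j + s) - (p * x j + q) * (r * x i + s)) / ((r * x i + s) * (r * x j + s))"
      unfolding yij using nz by (rule diff_frac_eq)
    also have "(p * x i + q) * (r * x j + s) - (p * x j + q) * (r * x i + s) = (p * s - q * r) * (x i - x j)"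
      by (simp add: algebra_simps)
    finally show ?thesis by (simp add: m_def)
  qed
  let ?D = "p * s - q * r"
  define L where "L = ?D * ?D * m a * m 1 * m 2 * m n"
  have mem: "a \<in> {1..n}" "1 \<in> {1..n}" "2 \<in> {1..n}" "n \<in> {1..n}" using assms(2) n by auto
  then have "L \<noteq> 0" using det m by (simp add: L_def)
  have "coord n y a = (L * ((x a - x 2) * (x n - x 1))) / (L * ((x a - x 1) * (x n - x 2)))"
    unfolding coord_def d[OF mem(1,3)] d[OF mem(4,2)] d[OF mem(1,2)] d[OF mem(4,3)] L_def
    by (rule arg_cong2[where f = "(/)"]) (simp_all only: mult_ac)
  also have "\<dots> = coord n x a" using \<open>L \<noteq> 0\<close> by (simp add: coord_def)
  finally show ?thesis by simp
qed

lemma mobius_if_coord_eq: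
  assumes x: "x \<in> config {1..n}" and y: "y \<in> config {1..n}"
    and eq: "\<And>a. a \<in> {2..n} \<Longrightarrow> coord n x a = coord n y a"
  shows "(x, y) \<in> mobius_rel {1..n}"
proof -
  have mem: "1 \<in> {1..n}" "2 \<in> {1..n}" "n \<in> {1..n}" "n \<noteq> 1" "n \<noteq> 2" using n by auto
  have nex: "x n - x 1 \<noteq> 0" "x n - x 2 \<noteq> 0" "x 1 - x 2 \<noteq> 0"
    using config_ne[OF x mem(3,1)] config_ne[OF x mem(3,2)] config_ne[OF x mem(1,2)] mem by auto
  have ney: "y n - y 1 \<noteq> 0" "y n - y 2 \<noteq> 0" "y 1 - y 2 \<noteq> 0"
    using config_ne[OF y mem(3,1)] config_ne[OF y mem(3,2)] config_ne[OF y mem(1,2)] mem by auto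
  define k where "k = (x n - x 1) / (x n - x 2)"
  define l where "l = (y n - y 1) / (y n - y 2)"
  have kl: "k \<noteq> 0" "l \<noteq> 0" using nex ney by (auto simp: k_def l_def)
  \<comment> \<open>The matrix of the map sending x to the normal form followed by the inverse of that for y.\<close>
  let ?p = "l * y 2 - k * y 1" and ?q = "k * x 2 * y 1 - l * x 1 * y 2"
  let ?r = "l - k" and ?s = "k * x 2 - l * x 1"
  have det: "?p * ?s - ?q * ?r = k * l * ((x 1 - x 2) * (y 1 - y 2))"
    by (simp add: algebra_simps)
  have "?r * x a + ?s \<noteq> 0 \<and> y a = (?p * x a + ?q) / (?r * x a + ?s)" if a: "a \<in> {1..n}" for a
  proof (cases "a = 1")
    case True
    have "?r * x a + ?s = - (k * (x 1 - x 2))" "?p * x a + ?q = y 1 * - (k * (x 1 - x 2))"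
      by (simp_all add: True algebra_simps)
    then show ?thesis using kl nex True by simp
  next
    case False
    have d: "x a - x 1 \<noteq> 0" "y a - y 1 \<noteq> 0"
      using config_ne[OF x a mem(1)] config_ne[OF y a mem(1)] False by auto
    have "coord n x a = coord n y a" using eq a False by simp
    then have E: "k * (x a - x 2) / (x a - x 1) = l * (y a - y 2) / (y a - y 1)"
      by (simp add: coord_def k_def l_def mult.commute)
    then have E': "k * (x a - x 2) * (y a - y 1) = l * (y a - y 2) * (x a - x 1)"
      using d by (simp add: frac_eq_eq)
    have den: "(?r * x a + ?s) * (y a - y 1) = l * (x a - x 1) * (y 2 - y 1)"
    proof -
      have "(?r * x a + ?s) * (y a - y 1) = l * (x a - x 1) * (y a - y 1) - k * (x a - x 2) * (y a - y 1)"
        by (simp add: algebra_simps)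
      then show ?thesis unfolding E' by (simp add: algebra_simps)
    qed
    moreover have "y 2 - y 1 \<noteq> 0" using ney(3) by auto
    ultimately have nz: "?r * x a + ?s \<noteq> 0" using kl d by auto
    have "y a * (?r * x a + ?s) - (?p * x a + ?q) = l * (y a - y 2) * (x a - x 1) - k * (x a - x 2) * (y a - y 1)"
      by (simp add: algebra_simps)
    then have "y a * (?r * x a + ?s) = ?p * x a + ?q" unfolding E' by simp
    with nz show ?thesis by (simp add: eq_divide_eq)
  qed
  moreover have "?p * ?s - ?q * ?r \<noteq> 0" unfolding det using kl nex ney by simp
  ultimately show ?thesis using x y unfolding mobius_rel_def by blast
qed

text \<open>\<open>normal_form\<close> is a complete invariant. Hence \<open>mobius_rel\<close> is
  the kernel of a map, and being an equivalence needs no composition or inversion of Moebius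
  maps.\<close>

lemma mobius_rel_iff:
  "(x, y) \<in> mobius_rel {1..n} \<longleftrightarrow> x \<in> config {1..n} \<and> y \<in> config {1..n} \<and> normal_form n x = normal_form n y"
proof
  assume *: "(x, y) \<in> mobius_rel {1..n}"
  have "normal_form n x = normal_form n y"
    unfolding normal_form_def by (rule restrict_ext) (use coord_mobius[OF *] in auto)
  with * show "x \<in> config {1..n} \<and> y \<in> config {1..n} \<and> normal_form n x = normal_form n y"
    by (simp add: mobius_rel_def)
next
  assume *: "x \<in> config {1..n} \<and> y \<in> config {1..n} \<and> normal_form n x = normal_form n y"
  have "coord n x a = coord n y a" if "a \<in> {2..n}" for a
  proof -
    have "normal_form n x a = normal_form n y a" using * by simp
    then show ?thesis using that by (auto simp: normal_form_def)
  qed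
  with * show "(x, y) \<in> mobius_rel {1..n}" by (intro mobius_if_coord_eq) auto
qed

lemma equiv_mobius_rel: "equiv (config {1..n}) (mobius_rel {1..n})"
proof (rule equivI)
  show "mobius_rel {1..n} \<subseteq> config {1..n} \<times> config {1..n}" by (auto simp: mobius_rel_def)
  show "refl_on (config {1..n}) (mobius_rel {1..n})" by (rule refl_onI) (unfold mobius_rel_iff, blast)
  show "sym (mobius_rel {1..n})" by (rule symI) (unfold mobius_rel_iff, simp)
  show "trans (mobius_rel {1..n})" by (rule transI) (unfold mobius_rel_iff, simp)
qed

text \<open>Every class contains exactly one normal form, and \<open>cross_ratio_eq_iff\<close>
  shows that the conditions on cross-ratios depend only on it. So orbits can be replaced by
  functions.\<close>

lemma card_cr_fiber:
  assumes V: "\<And>j. j < length V \<Longrightarrow> V ! j \<subseteq> {1..n} \<and> card (V ! j) = 4"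
  shows "card (cr_fiber {1..n} V y) = card {X \<in> normal_configs n. \<forall>j<length V. cr_eq (V ! j) (y j) X}"
proof -
  let ?R = "mobius_rel {1..n}"
  let ?N = "{X \<in> normal_configs n. \<forall>j<length V. cr_eq (V ! j) (y j) X}"
  have "\<forall>X\<in>normal_configs n. \<exists>x. x \<in> config {1..n} \<and> normal_form n x = X"
    using normal_form_surj by metis
  then obtain g where g: "\<And>X. X \<in> normal_configs n \<Longrightarrow> g X \<in> config {1..n}"
    "\<And>X. X \<in> normal_configs n \<Longrightarrow> normal_form n (g X) = X"
    by metis
  have cr: "(\<forall>j<length V. cross_ratio (V ! j) x = y j) \<longleftrightarrow> (\<forall>j<length V. cr_eq (V ! j) (y j) (normal_form n x))"
    if "x \<in> config {1..n}" for x
    using cross_ratio_eq_iff[OF that] V by blast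
  have "bij_betw (\<lambda>X. ?R `` {g X}) ?N (cr_fiber {1..n} V y)"
  proof (rule bij_betw_imageI)
    show "inj_on (\<lambda>X. ?R `` {g X}) ?N"
    proof (rule inj_onI)
      fix X Y assume *: "X \<in> ?N" "Y \<in> ?N" "?R `` {g X} = ?R `` {g Y}"
      then have "(g X, g Y) \<in> ?R"
        using eq_equiv_class[OF *(3) equiv_mobius_rel] g by blast
      then show "X = Y" using * g(2) unfolding mobius_rel_iff by auto
    qed
    show "(\<lambda>X. ?R `` {g X}) ` ?N = cr_fiber {1..n} V y"
    proof
      show "(\<lambda>X. ?R `` {g X}) ` ?N \<subseteq> cr_fiber {1..n} V y"
      proof
        fix C assume "C \<in> (\<lambda>X. ?R `` {g X}) ` ?N"
        then obtain X where X: "X \<in> ?N" "C = ?R `` {g X}" by blast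
        then have "g X \<in> C" "C \<in> M0 {1..n}"
          using g(1) equiv_class_self[OF equiv_mobius_rel] unfolding M0_def by (auto intro: quotientI)
        moreover have "\<forall>j<length V. cross_ratio (V ! j) (g X) = y j"
          using cr[of "g X"] g X by simp
        ultimately show "C \<in> cr_fiber {1..n} V y" by (auto simp: cr_fiber_def)
      qed
      show "cr_fiber {1..n} V y \<subseteq> (\<lambda>X. ?R `` {g X}) ` ?N"
      proof
        fix C assume "C \<in> cr_fiber {1..n} V y"
        then obtain x where C: "C \<in> config {1..n} // ?R" and x: "x \<in> C" "\<forall>j<length V. cross_ratio (V ! j) x = y j"
          by (auto simp: cr_fiber_def M0_def)
        have xc: "x \<in> config {1..n}" using in_quotient_imp_subset[OF equiv_mobius_rel C] x(1) by blast
        let ?X = "normal_form n x"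
        have X: "?X \<in> ?N" using cr[OF xc] x(2) normal_form_in_normal_configs[OF xc] by blast
        then have "(x, g ?X) \<in> ?R" using g xc unfolding mobius_rel_iff by simp
        moreover obtain x0 where "C = ?R `` {x0}" "x0 \<in> config {1..n}" using C by (rule quotientE)
        then have "C = ?R `` {x}" using equiv_class_eq[OF equiv_mobius_rel, of x0 x] x(1) by blast
        ultimately have "C = ?R `` {g ?X}" using equiv_class_eq[OF equiv_mobius_rel] by metis
        with X show "C \<in> (\<lambda>X. ?R `` {g X}) ` ?N" by blast
      qed
    qed
  qed
  then show ?thesis by (rule bij_betw_same_card[symmetric])
qed

end

section \<open>The fibre over a general point\<close>

locale polygon_triangulation =
  fixes n :: nat and T :: "(nat \<times> nat) set"
  assumes n4: "n \<ge> 4" and triang: "triangulation n T"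
begin

lemma diag:
  assumes "(a, b) \<in> T"
  shows "1 \<le> a" "a + 2 \<le> b" "b \<le> n" "b = n \<Longrightarrow> 2 \<le> a" "\<not> is_side n a b"
proof -
  have d: "1 \<le> a" "a < b" "b \<le> n" "\<not> is_side n a b"
    using triang assms by (auto simp: triangulation_def is_diag_def)
  then have "b \<noteq> Suc a" by (auto simp: is_side_def nxt_def)
  with d show "1 \<le> a" "a + 2 \<le> b" "b \<le> n" "\<not> is_side n a b" by auto
  show "2 \<le> a" if "b = n"
  proof (rule ccontr)
    assume "\<not> 2 \<le> a"
    with d have "a = 1" by simp
    with d that show False by (simp add: is_side_def nxt_def)
  qed
qed

sublocale noncrossing T
  using triang diag(2) by unfold_locales (auto simp: triangulation_def)

lemma inside_all: "inside 1 n = T"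
  using diag by (auto simp: inside_def)

lemma root_notin: "(1, n) \<notin> T"
  using diag(4)[of 1 n] by auto

lemma card_T: "card T + 3 = n"
  using triang n4 by (simp add: triangulation_def)

lemma full_root: "full 1 n"
  using card_T n4 root_notin unfolding full_def inside_all by simp

lemma interior_triangles_eq: "interior_triangles n T = card (tri 1 n)"
proof -
  have "{(a, b, c) \<in> triangles n T. \<not> is_side n a b \<and> \<not> is_side n b c \<and> \<not> is_side n a c} = tri 1 n"
  proof
    show "{(a, b, c) \<in> triangles n T. \<not> is_side n a b \<and> \<not> is_side n b c \<and> \<not> is_side n a c} \<subseteq> tri 1 n"
      by (auto simp: triangles_def tri_def edge_of_def)
    show "tri 1 n \<subseteq> {(a, b, c) \<in> triangles n T. \<not> is_side n a b \<and> \<not> is_side n b c \<and> \<not> is_side n a c}"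
    proof
      fix t assume "t \<in> tri 1 n"
      then obtain a b c where t: "t = (a, b, c)" "(a, b) \<in> T" "(b, c) \<in> T" "(a, c) \<in> T"
        by (auto simp: tri_def)
      show "t \<in> {(a, b, c) \<in> triangles n T. \<not> is_side n a b \<and> \<not> is_side n b c \<and> \<not> is_side n a c}"
        using t diag[OF t(2)] diag[OF t(3)] diag[OF t(4)] by (auto simp: triangles_def edge_of_def)
    qed
  qed
  then show ?thesis by (simp add: interior_triangles_def)
qed

text \<open>For b = n the smallest of the four labels is 1 = nxt n n, which rotates the arguments of the
cross-ratio.\<close>

definition std_ratio :: "nat \<Rightarrow> complex \<Rightarrow> complex" where
  "std_ratio b y = (if b = n then y / (y - 1) else y)"

lemma std_ratio_ne: "y \<noteq> 0 \<Longrightarrow> y \<noteq> 1 \<Longrightarrow> std_ratio b y \<noteq> 0 \<and> std_ratio b y \<noteq> 1"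
  by (auto simp: std_ratio_def)

lemma sorted_S_diag:
  assumes "(a, b) \<in> T"
  shows "sorted_list_of_set (S_diag n (a, b)) = (if b = n then [1, a, Suc a, n] else [a, Suc a, b, Suc b])"
proof (cases "b = n")
  case True
  have "S_diag n (a, b) = {1, a, Suc a, n}" using diag[OF assms] True by (auto simp: S_diag_def nxt_def)
  then show ?thesis using True diag[OF assms] by (simp add: sorted_list_of_set_4 del: One_nat_def)
next
  case False
  have "S_diag n (a, b) = {a, Suc a, b, Suc b}" using diag[OF assms] False by (auto simp: S_diag_def nxt_def)
  then show ?thesis using False diag[OF assms] by (simp add: sorted_list_of_set_4)
qed

lemma S_diag:
  assumes "(a, b) \<in> T"
  shows "S_diag n (a, b) \<subseteq> {1..n}" "card (S_diag n (a, b)) = 4"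
proof -
  show "S_diag n (a, b) \<subseteq> {1..n}" using diag[OF assms] n4 by (auto simp: S_diag_def nxt_def)
  have "length (sorted_list_of_set (S_diag n (a, b))) = 4" by (simp add: sorted_S_diag[OF assms])
  then show "card (S_diag n (a, b)) = 4" by simp
qed

text \<open>For \<open>b = n\<close> the cross-ratio is taken in the order 1, a, a + 1, n, while
  \<open>crel\<close> wants a, a + 1, n, n + 1 with point n + 1 equal to point 1. The Pluecker
  relation turns the equation into \<open>- P = y * (Q - P)\<close>, that is, ratio
  \<open>y / (y - 1)\<close>.\<close>

lemma cr_eq_iff_crel:
  assumes D: "(a, b) \<in> T" and X: "X (Suc n) = X 1" and "y \<noteq> 1"
  shows "cr_eq (S_diag n (a, b)) y X \<longleftrightarrow> crel (std_ratio b y) (X a) (X (Suc a)) (X b) (X (Suc b))"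
proof (cases "b = n")
  case False
  then show ?thesis by (simp add: cr_eq_def crel_def std_ratio_def sorted_S_diag[OF D])
next
  case True
  have l: "sorted_list_of_set (S_diag n (a, n)) = [1, a, Suc a, n]" using sorted_S_diag[OF D] True by simp
  define P where "P = br (X a) (X n) * br (X (Suc a)) (X 1)"
  define Q where "Q = br (X a) (X 1) * br (X (Suc a)) (X n)"
  have "cr_eq (S_diag n (a, b)) y X \<longleftrightarrow>
      br (X 1) (X (Suc a)) * br (X a) (X n) = y * (br (X 1) (X n) * br (X a) (X (Suc a)))"
    by (simp add: cr_eq_def True l)
  also have "br (X 1) (X (Suc a)) * br (X a) (X n) = - P"
    unfolding P_def br_swap[of "X 1" "X (Suc a)"] by simp
  also have "br (X 1) (X n) * br (X a) (X (Suc a)) = Q - P"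
    unfolding P_def Q_def by (rule plucker)
  also have "- P = y * (Q - P) \<longleftrightarrow> P * (y - 1) = y * Q"
    by (auto simp: algebra_simps)
  also have "\<dots> \<longleftrightarrow> P = y / (y - 1) * Q"
    using assms(3) by (simp add: eq_divide_eq)
  finally show ?thesis by (simp add: True crel_def std_ratio_def X P_def Q_def)
qed

abbreviation k :: nat where "k \<equiv> card T"

abbreviation L :: "(nat \<times> nat) list" where "L \<equiv> sorted_list_of_set T"

definition idx :: "nat \<times> nat \<Rightarrow> nat" where
  "idx D = (SOME j. j < k \<and> L ! j = D)"

lemma idx: "D \<in> T \<Longrightarrow> idx D < k" "D \<in> T \<Longrightarrow> L ! idx D = D"
proof -
  assume "D \<in> T"
  then have "\<exists>j. j < k \<and> L ! j = D" using fin by (metis in_set_conv_nth length_sorted_list_of_set set_sorted_list_of_set)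
  then have "idx D < k \<and> L ! idx D = D" unfolding idx_def by (rule someI_ex)
  then show "idx D < k" "L ! idx D = D" by auto
qed

lemma idx_inj: "D \<in> T \<Longrightarrow> E \<in> T \<Longrightarrow> idx D = idx E \<longleftrightarrow> D = E"
  using idx(2) by metis

lemma nth_L: "j < k \<Longrightarrow> L ! j \<in> T"
  using fin by (metis length_sorted_list_of_set nth_mem set_sorted_list_of_set)

lemma idx_nth: "j < k \<Longrightarrow> idx (L ! j) = j"
  using idx[of "L ! j"] nth_L[of j] nth_eq_iff_index_eq[of L "idx (L ! j)" j] by simp

definition \<eta> :: "(nat \<Rightarrow> complex) \<Rightarrow> nat \<times> nat \<Rightarrow> complex" where
  "\<eta> y D = std_ratio (snd D) (y (idx D))"

text \<open>Weak solutions in normal form: points 1, 2, n and n + 1 are infinity, 0, 1 and infinity,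
  and nonconsecutive points may still coincide.\<close>

definition solutions :: "(nat \<Rightarrow> complex) \<Rightarrow> (nat \<Rightarrow> complex \<times> complex) set" where
  "solutions y = weak_bd (\<eta> y) 1 n (1, 0) (0, 1) (1, 1) (1, 0)"

lemma target_ne:
  assumes "y \<in> cr_target k" "D \<in> T"
  shows "y (idx D) \<noteq> 0" "y (idx D) \<noteq> 1"
  using assms idx by (auto simp: cr_target_def)

lemma \<eta>_ne: "y \<in> cr_target k \<Longrightarrow> D \<in> T \<Longrightarrow> \<eta> y D \<noteq> 0 \<and> \<eta> y D \<noteq> 1"
  unfolding \<eta>_def by (intro std_ratio_ne target_ne)

lemma solutions_iff:
  assumes "y \<in> cr_target k"
  shows "X \<in> solutions y \<longleftrightarrow> X \<in> {1..Suc n} \<rightarrow>\<^sub>E PP \<and> (\<forall>i\<in>{1..n}. X i \<noteq> X (Suc i)) \<and>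
    (\<forall>j<k. cr_eq (S_diag n (L ! j)) (y j) X) \<and>
    X 1 = (1, 0) \<and> X 2 = (0, 1) \<and> X n = (1, 1) \<and> X (Suc n) = (1, 0)"
proof -
  have "(\<forall>a b. (a, b) \<in> T \<longrightarrow> crel (\<eta> y (a, b)) (X a) (X (Suc a)) (X b) (X (Suc b))) \<longleftrightarrow>
      (\<forall>j<k. cr_eq (S_diag n (L ! j)) (y j) X)" if "X (Suc n) = X 1"
  proof -
    have eq: "cr_eq (S_diag n (a, b)) (y (idx (a, b))) X \<longleftrightarrow> crel (\<eta> y (a, b)) (X a) (X (Suc a)) (X b) (X (Suc b))"
      if "(a, b) \<in> T" for a b
      using cr_eq_iff_crel[OF that \<open>X (Suc n) = X 1\<close> target_ne(2)[OF assms that]] by (simp add: \<eta>_def)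
    have "(\<forall>a b. (a, b) \<in> T \<longrightarrow> crel (\<eta> y (a, b)) (X a) (X (Suc a)) (X b) (X (Suc b))) \<longleftrightarrow>
        (\<forall>D\<in>T. cr_eq (S_diag n D) (y (idx D)) X)"
      using eq by (metis surj_pair)
    also have "\<dots> \<longleftrightarrow> (\<forall>j<k. cr_eq (S_diag n (L ! j)) (y j) X)"
      using idx idx_nth nth_L by metis
    finally show ?thesis .
  qed
  moreover have "X \<in> solutions y \<longleftrightarrow> X \<in> {1..Suc n} \<rightarrow>\<^sub>E PP \<and> (\<forall>i\<in>{1..n}. X i \<noteq> X (Suc i)) \<and>
    (\<forall>a b. (a, b) \<in> T \<longrightarrow> crel (\<eta> y (a, b)) (X a) (X (Suc a)) (X b) (X (Suc b))) \<and>
    X 1 = (1, 0) \<and> X 2 = (0, 1) \<and> X n = (1, 1) \<and> X (Suc n) = (1, 0)"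
  proof -
    have two: "Suc 1 = 2" by simp
    show ?thesis
      unfolding solutions_def weak_bd_def weak_def inside_all two mem_Collect_eq by (simp only: conj_assoc)
  qed
  ultimately show ?thesis by metis
qed

lemma normal_configs_eq:
  assumes "y \<in> cr_target k"
  shows "{X \<in> normal_configs n. \<forall>j<k. cr_eq (S_diag n (L ! j)) (y j) X} = {X \<in> solutions y. inj_on X {1..n}}"
proof -
  have "\<forall>i\<in>{1..n}. X i \<noteq> X (Suc i)" if X: "X \<in> normal_configs n" for X
  proof
    fix i assume i: "i \<in> {1..n}"
    show "X i \<noteq> X (Suc i)"
    proof (cases "i = n")
      case True
      then show ?thesis using X by (simp add: normal_configs_def)
    next
      case False
      then have "Suc i \<in> {1..n}" using i by simp
      moreover have "inj_on X {1..n}" using X by (simp add: normal_configs_def)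
      ultimately show ?thesis using inj_onD[of X "{1..n}" i "Suc i"] i by auto
    qed
  qed
  then show ?thesis
    unfolding set_eq_iff mem_Collect_eq solutions_iff[OF assms] unfolding normal_configs_def mem_Collect_eq
    by blast
qed

section \<open>Degenerate solutions\<close>

text \<open>Charts for the degenerate solutions: point j coincides with point i, the free points in J
are at infinity, the others have coordinates t.\<close>

definition chart_pt :: "nat set \<Rightarrow> (nat \<Rightarrow> complex) \<Rightarrow> nat \<Rightarrow> complex \<times> complex" where
  "chart_pt J t a = (if a = 1 then (1, 0) else if a = 2 then (0, 1) else if a = n then (1, 1)
     else if a \<in> J then (1, 0) else (t a, 1))"

definition chart :: "nat \<Rightarrow> nat \<Rightarrow> nat set \<Rightarrow> (nat \<Rightarrow> complex) \<Rightarrow> nat \<Rightarrow> complex \<times> complex" where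
  "chart i j J t a = chart_pt J t (if a = j then i else a)"

lemma deg_le_br_chart: "deg_le I 2 (\<lambda>t. br (chart i j J t a) (chart i j J t b))"
proof -
  have "deg_le I 1 (\<lambda>t. fst (chart_pt J t a))" "deg_le I 1 (\<lambda>t. snd (chart_pt J t a))" for a
  proof -
    have "(\<exists>c. \<forall>t. chart_pt J t a = c) \<or> (\<forall>t. chart_pt J t a = (t a, 1))"
      by (auto simp: chart_pt_def)
    then show "deg_le I 1 (\<lambda>t. fst (chart_pt J t a))" "deg_le I 1 (\<lambda>t. snd (chart_pt J t a))"
      using deg_le_var[of I a] deg_le_const[of I 1] by auto
  qed
  then have "deg_le I (1 + 1) (\<lambda>t. br (chart i j J t a) (chart i j J t b))"
    unfolding br_def chart_def by (intro deg_le_diff deg_le_mult)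
  then show ?thesis by (simp only: one_add_one)
qed

text \<open>Shaped for \<open>generic_not_in_image\<close>: \<open>y\<close> is a value of a tuple
  of quotients of polynomials in the parameters. The nonvanishing of the denominators matters, since
  otherwise an equation could read 0 = 0 and not constrain \<open>y\<close>.\<close>

definition degenerate :: "nat \<Rightarrow> nat \<Rightarrow> nat set \<Rightarrow> (nat \<Rightarrow> complex) \<Rightarrow> bool" where
  "degenerate i j J y \<longleftrightarrow> (\<exists>t. (\<forall>a. a \<notin> {3..<n} - {j} \<longrightarrow> t a = 0) \<and>
     (\<forall>m<k. let l = sorted_list_of_set (S_diag n (L ! m)); X = chart i j J t in
        br (X (l!0)) (X (l!3)) * br (X (l!1)) (X (l!2)) \<noteq> 0 \<and>
        br (X (l!0)) (X (l!2)) * br (X (l!1)) (X (l!3)) = y m * (br (X (l!0)) (X (l!3)) * br (X (l!1)) (X (l!2)))))"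

lemma generic_not_degenerate:
  assumes "j \<in> {3..<n}"
  shows "generic k (\<lambda>y. \<not> degenerate i j J y)"
proof -
  let ?l = "\<lambda>m. sorted_list_of_set (S_diag n (L ! m))"
  let ?X = "chart i j J"
  have "card ({3..<n} - {j}) = n - 4" using assms by simp
  then have "card ({3..<n} - {j}) < k" using card_T n4 by linarith
  \<comment> \<open>Two brackets, each of degree at most 2 in every parameter.\<close>
  moreover have "deg_le ({3..<n} - {j}) 4 (\<lambda>t. br (?X t a) (?X t b) * br (?X t c) (?X t d))" for a b c d
  proof -
    have "deg_le ({3..<n} - {j}) (2 + 2) (\<lambda>t. br (?X t a) (?X t b) * br (?X t c) (?X t d))"
      by (intro deg_le_mult deg_le_br_chart)
    then show ?thesis by simp
  qed
  ultimately show ?thesis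
    unfolding degenerate_def Let_def
    by (intro generic_not_in_image[of "{3..<n} - {j}" k 4
      "\<lambda>m t. br (?X t (?l m!0)) (?X t (?l m!2)) * br (?X t (?l m!1)) (?X t (?l m!3))"
      "\<lambda>m t. br (?X t (?l m!0)) (?X t (?l m!3)) * br (?X t (?l m!1)) (?X t (?l m!2))"]) simp_all
qed

lemma inj_on_if_not_degenerate:
  assumes y: "y \<in> cr_target k" and X: "X \<in> solutions y"
    and nd: "\<And>i j J. i \<in> {1..n} \<Longrightarrow> j \<in> {3..<n} \<Longrightarrow> J \<subseteq> {3..<n} \<Longrightarrow> \<not> degenerate i j J y"
  shows "inj_on X {1..n}"
proof (rule ccontr)
  assume "\<not> inj_on X {1..n}"
  then obtain i0 j0 where ij0: "i0 \<in> {1..n}" "j0 \<in> {1..n}" "i0 \<noteq> j0" "X i0 = X j0"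
    by (auto simp: inj_on_def)
  have XE: "X \<in> {1..Suc n} \<rightarrow>\<^sub>E PP" and cons: "\<And>a. a \<in> {1..n} \<Longrightarrow> X a \<noteq> X (Suc a)"
    and cr: "\<And>m. m < k \<Longrightarrow> cr_eq (S_diag n (L ! m)) (y m) X"
    and X1: "X 1 = (1, 0)" and X2: "X 2 = (0, 1)" and Xn: "X n = (1, 1)" and XS: "X (Suc n) = (1, 0)"
    using X solutions_iff[OF y] by blast+
  have PP: "X a \<in> PP" if "a \<in> {1..Suc n}" for a using PiE_mem[OF XE that] .
  \<comment> \<open>The three normalised points are distinct, so a free point takes part in the
    coincidence; it becomes \<open>j\<close>, the point whose parameter is dropped.\<close>
  have "i0 \<in> {3..<n} \<or> j0 \<in> {3..<n}"
  proof (rule ccontr)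
    assume "\<not> ?thesis"
    then have "i0 = 1 \<or> i0 = 2 \<or> i0 = n" "j0 = 1 \<or> j0 = 2 \<or> j0 = n" using ij0 by auto
    then show False using ij0 X1 X2 Xn by (metis Pair_inject zero_neq_one)
  qed
  then obtain i j where ij: "i \<in> {1..n}" "j \<in> {3..<n}" "i \<noteq> j" "X i = X j"
    using ij0 by metis
  define J where "J = {a \<in> {3..<n}. X a = (1, 0)}"
  define t where "t a = (if a \<in> {3..<n} - {j} then fst (X a) else 0)" for a
  have pt: "chart_pt J t a = X a" if "a \<in> {1..n}" "a \<noteq> j" for a
  proof (cases "a \<in> {3..<n}")
    case True
    then have "a \<noteq> 1" "a \<noteq> 2" "a \<noteq> n" "a \<in> {1..Suc n}" by auto
    then show ?thesis using PP[of a] True that by (auto simp: chart_pt_def J_def t_def PP_def)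
  next
    case False
    then have "a = 1 \<or> a = 2 \<or> a = n" using that by auto
    then show ?thesis using X1 X2 Xn n4 by (auto simp: chart_pt_def)
  qed
  have chart: "chart i j J t a = X a" if "a \<in> {1..n}" for a
    using pt[of i] pt[of a] ij that by (auto simp: chart_def)
  have "degenerate i j J y"
    unfolding degenerate_def
  proof (rule exI[of _ t], intro conjI allI impI)
    show "t a = 0" if "a \<notin> {3..<n} - {j}" for a using that unfolding t_def by (rule if_not_P)
    fix m assume m: "m < k"
    obtain a b where ab: "L ! m = (a, b)" by (cases "L ! m")
    then have T: "(a, b) \<in> T" using nth_L[OF m] by simp
    let ?l = "sorted_list_of_set (S_diag n (L ! m))"
    have set: "set ?l \<subseteq> {1..n}" "length ?l = 4"
      using S_diag[OF T] finite_subset[OF S_diag(1)[OF T]] by (auto simp: ab)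
    then have "?l ! q \<in> {1..n}" if "q < 4" for q using that by (metis nth_mem subsetD)
    then have ch: "chart i j J t (?l!0) = X (?l!0)" "chart i j J t (?l!1) = X (?l!1)"
      "chart i j J t (?l!2) = X (?l!2)" "chart i j J t (?l!3) = X (?l!3)"
      by (intro chart; simp)+
    have d: "1 \<le> a" "a + 2 \<le> b" "b \<le> n" using diag[OF T] by auto
    \<comment> \<open>For \<open>b = n\<close> only the normalised points 1 and n and the
      consecutive points a and a + 1 occur. Otherwise consecutive distinctness and
      \<open>crel_distinct\<close> separate the points.\<close>
    have "br (X (?l!0)) (X (?l!3)) * br (X (?l!1)) (X (?l!2)) \<noteq> 0"
    proof (cases "b = n")
      case True
      have "X 1 \<noteq> X n" by (simp only: X1 Xn) simp
      moreover have "X a \<noteq> X (Suc a)" using cons[of a] d by simp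
      moreover have "sorted_list_of_set (S_diag n (a, n)) = [1, a, Suc a, n]"
        using sorted_S_diag[OF T] True by simp
      moreover have "X 1 \<in> PP" "X n \<in> PP" "X a \<in> PP" "X (Suc a) \<in> PP" using d n4 by (intro PP; simp)+
      ultimately show ?thesis using True by (simp add: ab br_eq_0_iff)
    next
      case False
      have P: "X a \<in> PP" "X (Suc a) \<in> PP" "X b \<in> PP" "X (Suc b) \<in> PP" using d by (intro PP; simp)+
      have "X (Suc n) = X 1" by (simp only: X1 XS)
      then have "crel (std_ratio b (y m)) (X a) (X (Suc a)) (X b) (X (Suc b))"
        using cr_eq_iff_crel[OF T _ , of X "y m"] cr[OF m] y m by (auto simp: ab cr_target_def)
      moreover have "std_ratio b (y m) \<noteq> 0" using y m std_ratio_ne[of "y m" b] by (auto simp: cr_target_def)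
      ultimately have "X a \<noteq> X (Suc b)" "X (Suc a) \<noteq> X b"
        using crel_distinct P cons[of a] cons[of b] d by auto
      then show ?thesis using False P by (simp add: ab sorted_S_diag[OF T] br_eq_0_iff)
    qed
    then show "let l = ?l; X = chart i j J t in
        br (X (l!0)) (X (l!3)) * br (X (l!1)) (X (l!2)) \<noteq> 0 \<and>
        br (X (l!0)) (X (l!2)) * br (X (l!1)) (X (l!3)) = y m * (br (X (l!0)) (X (l!3)) * br (X (l!1)) (X (l!2)))"
      using cr[OF m] unfolding Let_def ch cr_eq_def by blast
  qed
  moreover have "J \<subseteq> {3..<n}" by (auto simp: J_def)
  ultimately show False using nd ij by blast
qed

section \<open>The exceptional loci and the final count\<close>

lemma generic_disc:
  assumes "(a, b) \<in> T" "(b, c) \<in> T" "(a, c) \<in> T"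
  shows "generic k (\<lambda>y. y \<in> cr_target k \<longrightarrow> tri_disc (\<eta> y (a, b)) (\<eta> y (b, c)) (\<eta> y (a, c)) \<noteq> 0)"
proof -
  \<comment> \<open>The denominator of \<open>std_ratio\<close>; \<open>f\<close> below is
    \<open>tri_disc\<close> times the square of the product of the three denominators.\<close>
  define den :: "nat \<Rightarrow> complex \<Rightarrow> complex" where "den v z = (if v = n then z - 1 else 1)" for v z
  define f where "f = (\<lambda>y. let A = y (idx (a, b)); B = y (idx (b, c)); C = y (idx (a, c));
       A' = den b A; B' = den c B; C' = den c C in
     (A * B' * C' + C * A' * B' - B * (A' * C' + A * C)) ^ 2 - 4 * A * C * A' * C' * (B' - B) ^ 2)"
  have den: "poly_fun k (\<lambda>y. den v (y (idx D)))" if "D \<in> T" for v D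
    unfolding den_def using idx(1)[OF that] by (cases "v = n") (auto intro!: poly_fun_intros)
  have pf: "poly_fun k f"
    unfolding f_def Let_def by (intro poly_fun_intros den idx(1) assms)
  have "a < b" "b < c" using long assms by fastforce+
  then have "idx (a, b) \<noteq> idx (b, c)" "idx (a, b) \<noteq> idx (a, c)" "idx (b, c) \<noteq> idx (a, c)"
    using assms by (auto simp: idx_inj)
  \<comment> \<open>With \<open>B = 0\<close> the polynomial is
    \<open>B' ^ 2 * (A * C' - C * A') ^ 2\<close>, and the values 2 and -1 for \<open>A\<close> and
    \<open>C\<close> keep it nonzero whether or not the denominators are trivial. Prescribing them
    independently requires the three indices to be distinct.\<close>
  then have "f (\<lambda>i. if i = idx (a, b) then 2 else if i = idx (b, c) then 0 else -1) \<noteq> 0"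
    by (auto simp: f_def den_def power2_eq_square)
  moreover have "tri_disc (\<eta> y (a, b)) (\<eta> y (b, c)) (\<eta> y (a, c)) \<noteq> 0" if "y \<in> cr_target k" "f y \<noteq> 0" for y
  proof -
    define A B C where "A = y (idx (a, b))" and "B = y (idx (b, c))" and "C = y (idx (a, c))"
    define A' B' C' where "A' = den b A" and "B' = den c B" and "C' = den c C"
    have nz: "A' \<noteq> 0" "B' \<noteq> 0" "C' \<noteq> 0"
      using target_ne[OF that(1)] assms by (auto simp: A'_def B'_def C'_def A_def B_def C_def den_def)
    have \<eta>: "\<eta> y (a, b) = A / A'" "\<eta> y (b, c) = B / B'" "\<eta> y (a, c) = C / C'"
      by (auto simp: \<eta>_def std_ratio_def A_def B_def C_def A'_def B'_def C'_def den_def)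
    have "(A / A' + C / C' - B / B' * (1 + A / A' * (C / C'))) * (A' * B' * C')
        = A * B' * C' + C * A' * B' - B * (A' * C' + A * C)"
      using nz by (simp add: field_simps)
    moreover have "4 * (A / A') * (C / C') * (1 - B / B') ^ 2 * (A' * B' * C') ^ 2 = 4 * A * C * A' * C' * (B' - B) ^ 2"
    proof -
      have "(1 - B / B') * B' = B' - B" using nz by (simp add: field_simps)
      then have "(B' - B) ^ 2 = (1 - B / B') ^ 2 * B' ^ 2" by (metis power_mult_distrib)
      then show ?thesis using nz by (simp add: power2_eq_square)
    qed
    ultimately have "tri_disc (\<eta> y (a, b)) (\<eta> y (b, c)) (\<eta> y (a, c)) * (A' * B' * C') ^ 2 = f y"
      unfolding tri_disc_def \<eta> f_def Let_def A_def[symmetric] B_def[symmetric] C_def[symmetric]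
        A'_def[symmetric] B'_def[symmetric] C'_def[symmetric] left_diff_distrib power_mult_distrib[symmetric]
      by (simp only:)
    with that(2) show ?thesis by auto
  qed
  ultimately show ?thesis by (intro genericI[OF pf]) auto
qed

lemma generic_root:
  assumes "(1, w) \<in> T" "(w, n) \<in> T"
  shows "generic k (\<lambda>y. y \<in> cr_target k \<longrightarrow> \<eta> y (1, w) * \<eta> y (w, n) \<noteq> 1)"
proof (rule genericI)
  \<comment> \<open>The diagonal \<open>(w, n)\<close> ends at \<open>n\<close>, so its ratio is
    \<open>y / (y - 1)\<close>; \<open>?f\<close> is the condition on the product with that
    denominator cleared.\<close>
  let ?f = "\<lambda>y :: nat \<Rightarrow> complex. y (idx (1, w)) * y (idx (w, n)) - (y (idx (w, n)) - 1)"
  show "poly_fun k ?f" by (intro poly_fun_intros idx(1) assms)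
  show "?f (\<lambda>_. 0) \<noteq> 0" by simp
  fix y assume f: "?f y \<noteq> 0"
  have "w \<noteq> n" using diag[OF assms(2)] by simp
  show "y \<in> cr_target k \<longrightarrow> \<eta> y (1, w) * \<eta> y (w, n) \<noteq> 1"
  proof (intro impI notI)
    assume "y \<in> cr_target k" and *: "\<eta> y (1, w) * \<eta> y (w, n) = 1"
    then have "y (idx (w, n)) - 1 \<noteq> 0" using target_ne(2) assms by auto
    with * have "y (idx (1, w)) * y (idx (w, n)) = y (idx (w, n)) - 1"
      using \<open>w \<noteq> n\<close> by (simp add: \<eta>_def std_ratio_def divide_eq_eq)
    with f show False by simp
  qed
qed

lemma card_solutions:
  assumes y: "y \<in> cr_target k"
    and disc: "\<And>a b c. (a, b, c) \<in> tri 1 n \<Longrightarrow> tri_disc (\<eta> y (a, b)) (\<eta> y (b, c)) (\<eta> y (a, c)) \<noteq> 0"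
    and root: "\<And>w. (1, w) \<in> T \<Longrightarrow> (w, n) \<in> T \<Longrightarrow> \<eta> y (1, w) * \<eta> y (w, n) \<noteq> 1"
  shows "card (solutions y) = 2 ^ card (tri 1 n)"
  unfolding solutions_def
proof (rule card_weak_bd_root)
  show "\<eta> y D \<noteq> 0 \<and> \<eta> y D \<noteq> 1" if "D \<in> T" for D using \<eta>_ne[OF y that] .
  show "tri_disc (\<eta> y (a, b)) (\<eta> y (b, c)) (\<eta> y (a, c)) \<noteq> 0" if "(a, b) \<in> T" "(b, c) \<in> T" "(a, c) \<in> T" for a b c
  proof (rule disc)
    show "(a, b, c) \<in> tri 1 n" using that diag(1)[OF that(1)] diag(3)[OF that(2)] by (simp add: tri_def)
  qed
  show "\<eta> y (1, w) * \<eta> y (w, n) \<noteq> 1" if "(1, w) \<in> T" "(w, n) \<in> T" for w using root[OF that] .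
  show "full 1 n" "(1, n) \<notin> T" by (rule full_root root_notin)+
  show "1 + 2 \<le> n" using n4 by simp
qed (simp_all add: PP_def)

text \<open>Finitely many exceptional loci are avoided at once: one discriminant per interior
  triangle, the condition at the root triangle, and the image of every chart. Off them all weak
  solutions are injective, so their number is that of the fibre.\<close>

lemma generic_card_fiber:
  "generic k (\<lambda>y. y \<in> cr_target k \<longrightarrow> card (cr_fiber {1..n} (map (S_diag n) L) y) = 2 ^ card (tri 1 n))"
proof -
  have "generic k (\<lambda>y. \<forall>t\<in>tri 1 n. case t of (a, b, c) \<Rightarrow>
      y \<in> cr_target k \<longrightarrow> tri_disc (\<eta> y (a, b)) (\<eta> y (b, c)) (\<eta> y (a, c)) \<noteq> 0)"
    by (rule generic_ball[OF finite_tri]) (auto simp: tri_def intro: generic_disc)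
  moreover have "generic k (\<lambda>y. \<forall>w\<in>{w \<in> {1..n}. (1, w) \<in> T \<and> (w, n) \<in> T}.
      y \<in> cr_target k \<longrightarrow> \<eta> y (1, w) * \<eta> y (w, n) \<noteq> 1)"
    by (rule generic_ball) (use generic_root in auto)
  moreover have "generic k (\<lambda>y. \<forall>i\<in>{1..n}. \<forall>j\<in>{3..<n}. \<forall>J\<in>Pow {3..<n}. \<not> degenerate i j J y)"
    by (rule generic_ball[OF finite_atLeastAtMost], rule generic_ball[OF finite_atLeastLessThan],
        rule generic_ball, simp, rule generic_not_degenerate)
  ultimately have "generic k (\<lambda>y. (\<forall>t\<in>tri 1 n. case t of (a, b, c) \<Rightarrow>
      y \<in> cr_target k \<longrightarrow> tri_disc (\<eta> y (a, b)) (\<eta> y (b, c)) (\<eta> y (a, c)) \<noteq> 0) \<and>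
    (\<forall>w\<in>{w \<in> {1..n}. (1, w) \<in> T \<and> (w, n) \<in> T}. y \<in> cr_target k \<longrightarrow> \<eta> y (1, w) * \<eta> y (w, n) \<noteq> 1) \<and>
    (\<forall>i\<in>{1..n}. \<forall>j\<in>{3..<n}. \<forall>J\<in>Pow {3..<n}. \<not> degenerate i j J y))" (is "generic k ?G")
    by (intro generic_conj)
  then show ?thesis
  proof (rule generic_mono, intro impI)
    fix y assume G: "?G y" and y: "y \<in> cr_target k"
    have disc: "tri_disc (\<eta> y (a, b)) (\<eta> y (b, c)) (\<eta> y (a, c)) \<noteq> 0" if "(a, b, c) \<in> tri 1 n" for a b c
      using bspec[OF conjunct1[OF G] that] y by simp
    have root: "\<eta> y (1, w) * \<eta> y (w, n) \<noteq> 1" if "(1, w) \<in> T" "(w, n) \<in> T" for w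
      using bspec[OF conjunct1[OF conjunct2[OF G]], of w] that diag(2,3)[OF that(1)] y by simp
    have nd: "\<not> degenerate i j J y" if "i \<in> {1..n}" "j \<in> {3..<n}" "J \<subseteq> {3..<n}" for i j J
      using conjunct2[OF conjunct2[OF G]] that by blast
    have "map (S_diag n) L ! j \<subseteq> {1..n} \<and> card (map (S_diag n) L ! j) = 4" if "j < length (map (S_diag n) L)" for j
    proof -
      obtain a b where "L ! j = (a, b)" by (cases "L ! j")
      then show ?thesis using that nth_L[of j] S_diag[of a b] by simp
    qed
    then have "card (cr_fiber {1..n} (map (S_diag n) L) y) = card {X \<in> solutions y. inj_on X {1..n}}"
      using card_cr_fiber[of n "map (S_diag n) L" y] n4 normal_configs_eq[OF y] by simp
    also have "{X \<in> solutions y. inj_on X {1..n}} = solutions y"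
      using inj_on_if_not_degenerate[OF y _ nd] by blast
    also have "card (solutions y) = 2 ^ card (tri 1 n)"
      by (rule card_solutions[OF y disc root])
    finally show "card (cr_fiber {1..n} (map (S_diag n) L) y) = 2 ^ card (tri 1 n)" .
  qed
qed

lemma d_T_eq: "d_T n T = 2 ^ interior_triangles n T"
  unfolding d_T_def interior_triangles_eq
  by (rule cr_degree_eqI) (use generic_card_fiber card_T in simp_all)

end

theorem theorem1p1:
  fixes n :: nat and T :: "(nat \<times> nat) set"
  assumes "n \<ge> 4" and "triangulation n T"
  shows "d_T n T = 2 ^ interior_triangles n T"
proof -
  interpret polygon_triangulation n T using assms by unfold_locales
  show ?thesis by (rule d_T_eq)
qed

end
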